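(* The pair $\{P_4,P_4\}$ is unavoidable in $\mathcal{K}_{\mathrm{MOP}}$, with $r_{\mathrm{MOP}}(P_4,P_4)=5$.
   Context: All graphs are finite and simple; copies are subgraphs, not necessarily induced. A graph is maximal outerplanar if it is outerplanar (drawable in the plane without crossings with all vertices on the outer face) and adding any edge between two non-adjacent vertices destroys outerplanarity; $\mathcal{K}_{\mathrm{MOP}}$ is the class of all maximal outerplanar graphs. A pair $\{H,F\}$ is unavoidable in $\mathcal{K}_{\mathrm{MOP}}$ if there exists $N$ such that for every maximal outerplanar graph $G$ on at least $N$ vertices, every red/blue colouring of the edges of $G$ contains a red copy of $H$ or a blue copy of $F$; the least such positive integer $N$ is denoted $r_{\mathrm{MOP}}(H,F)$. $P_4$ is the path on 4 vertices. *)

theory Defs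
  imports "HOL-Analysis.Analysis" "HOL-Library.Infinite_Typeclass"
begin

record 'a sgraph =
  verts :: "'a set"
  edges :: "'a set set"

definition simple_graph :: "'a sgraph \<Rightarrow> bool" where
  "simple_graph G \<longleftrightarrow>
     finite (verts G) \<and> (\<forall>e \<in> edges G. e \<subseteq> verts G \<and> card e = 2)"

text \<open>The Euclidean plane is \<^typ>\<open>complex\<close>. The vertex \<open>v\<close> is drawn as the point \<open>p v\<close> and
  the edge \<open>e\<close> as the arc (injective path) \<open>\<gamma> e\<close> joining the two points of \<open>p ` e\<close>. No edge
  passes through a vertex other than its ends, and distinct edges meet only in common ends.\<close>

definition plane_drawing ::
    "'a sgraph \<Rightarrow> ('a \<Rightarrow> complex) \<Rightarrow> ('a set \<Rightarrow> real \<Rightarrow> complex) \<Rightarrow> bool" where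
  "plane_drawing G p \<gamma> \<longleftrightarrow>
     inj_on p (verts G) \<and>
     (\<forall>e \<in> edges G. arc (\<gamma> e) \<and> {pathstart (\<gamma> e), pathfinish (\<gamma> e)} = p ` e) \<and>
     (\<forall>e \<in> edges G. \<forall>v \<in> verts G. p v \<in> path_image (\<gamma> e) \<longrightarrow> v \<in> e) \<and>
     (\<forall>e \<in> edges G. \<forall>f \<in> edges G. e \<noteq> f \<longrightarrow>
        path_image (\<gamma> e) \<inter> path_image (\<gamma> f) \<subseteq> p ` (e \<inter> f))"

definition drawing_image ::
    "'a sgraph \<Rightarrow> ('a \<Rightarrow> complex) \<Rightarrow> ('a set \<Rightarrow> real \<Rightarrow> complex) \<Rightarrow> complex set" where
  "drawing_image G p \<gamma> = p ` verts G \<union> (\<Union>e \<in> edges G. path_image (\<gamma> e))"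

text \<open>The image of a drawing of a finite graph is compact, so its \<^const>\<open>outside\<close> is the unique
  unbounded component of its complement, i.e. the outer face. A vertex lies on the outer face
  when it belongs to the boundary of that face.\<close>

definition outerplanar :: "'a sgraph \<Rightarrow> bool" where
  "outerplanar G \<longleftrightarrow> simple_graph G \<and>
     (\<exists>p \<gamma>. plane_drawing G p \<gamma> \<and>
            (\<forall>v \<in> verts G. p v \<in> frontier (outside (drawing_image G p \<gamma>))))"

definition maximal_outerplanar :: "'a sgraph \<Rightarrow> bool" where
  "maximal_outerplanar G \<longleftrightarrow> outerplanar G \<and>
     (\<forall>u \<in> verts G. \<forall>v \<in> verts G. u \<noteq> v \<and> {u, v} \<notin> edges G \<longrightarrow>
        \<not> outerplanar (G\<lparr>edges := insert {u, v} (edges G)\<rparr>))"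

definition K_MOP :: "'a sgraph set" where
  "K_MOP = {G. maximal_outerplanar G}"

definition contains_copy :: "'a sgraph \<Rightarrow> 'b sgraph \<Rightarrow> bool" where
  "contains_copy G H \<longleftrightarrow>
     (\<exists>f. inj_on f (verts H) \<and> f ` verts H \<subseteq> verts G \<and> (\<forall>e \<in> edges H. f ` e \<in> edges G))"

datatype colour = Red | Blue

definition colour_class :: "'a sgraph \<Rightarrow> ('a set \<Rightarrow> colour) \<Rightarrow> colour \<Rightarrow> 'a sgraph" where
  "colour_class G c k = G\<lparr>edges := {e \<in> edges G. c e = k}\<rparr>"

definition forces_from :: "'a sgraph set \<Rightarrow> 'b sgraph \<Rightarrow> 'c sgraph \<Rightarrow> nat \<Rightarrow> bool" where
  "forces_from K H F N \<longleftrightarrow>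
     (\<forall>G \<in> K. N \<le> card (verts G) \<longrightarrow>
        (\<forall>c. contains_copy (colour_class G c Red) H \<or> contains_copy (colour_class G c Blue) F))"

definition unavoidable :: "'a sgraph set \<Rightarrow> 'b sgraph \<Rightarrow> 'c sgraph \<Rightarrow> bool" where
  "unavoidable K H F \<longleftrightarrow> (\<exists>N. forces_from K H F N)"

text \<open>This is the intended number only if the pair is \<^const>\<open>unavoidable\<close> in \<open>K\<close>; otherwise
  \<^const>\<open>Least\<close> returns an unspecified value.\<close>

definition ramsey_in :: "'a sgraph set \<Rightarrow> 'b sgraph \<Rightarrow> 'c sgraph \<Rightarrow> nat" where
  "ramsey_in K H F = (LEAST N. 0 < N \<and> forces_from K H F N)"

definition path_graph :: "nat \<Rightarrow> nat sgraph" where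
  "path_graph n = \<lparr>verts = {..<n}, edges = {{i, Suc i} | i. Suc i < n}\<rparr>"

end

theory Submission
  imports Defs
begin

text \<open>
  The content is that a maximal outerplanar graph, defined here through topological drawings, is a
  triangulated polygon. Once this is known, a graph with at least five vertices contains three
  triangles glued along edges, that is, a fan consisting of a path on four vertices and a hub
  adjacent to all of them (\<open>maximal_outerplanar_contains_fan\<close>), and every colouring of the seven
  edges of the fan has a monochromatic path on four vertices (\<open>fan_monochromatic_P4\<close>). Conversely
  \<open>K\<^sub>4\<close> minus an edge has a colouring without one, so five is optimal.

  The passage from drawings to combinatorics goes through two obstructions. Of three internally
  disjoint arcs with common ends, one lies inside the closed curve formed by the other two
  (\<open>theta_middle_arc\<close>, from the Jordan curve theorem and Janiszewski's theorem). A middle arc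
  cannot contain a vertex of the outer face in its interior. Hence an outerplanar graph has neither a
  subdivision of \<open>K\<^sub>2\<^sub>,\<^sub>3\<close> nor a cycle with two crossing chords (\<open>outerplanar_no_obstruction\<close>).

  A graph without these obstructions has a linear order of the vertices in which no two edges cross
  (\<open>noncrossing_order_exists\<close>): cut at a vertex as long as possible; a graph that cannot be cut has a
  Hamiltonian cycle, as an ear of a longest cycle gives a longer cycle or a subdivision of
  \<open>K\<^sub>2\<^sub>,\<^sub>3\<close>, and then its chords do not cross. In turn, a graph with such an order is outerplanar, by
  placing the vertices on a parabola (\<open>outerplanar_if_noncrossing\<close>). So maximality under
  outerplanarity means that every edge that could be added without crossing is present, which yields
  the triangles.
\<close>

section \<open>Theta curves in the plane\<close>

text \<open>Only the point set of an arc matters below, and an unoriented drawn edge has to serve in either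
  direction; so the parametrisation is hidden.\<close>

definition arc_between :: "complex \<Rightarrow> complex \<Rightarrow> complex set \<Rightarrow> bool" where
  "arc_between a b A \<longleftrightarrow> (\<exists>g. arc g \<and> pathstart g = a \<and> pathfinish g = b \<and> path_image g = A)"

lemma arc_between_props:
  assumes "arc_between a b A"
  shows "compact A" "connected A" "connected (A - {a, b})" "A - {a, b} \<noteq> {}" "a \<in> A" "b \<in> A"
proof -
  obtain g where g: "arc g" "pathstart g = a" "pathfinish g = b" "path_image g = A"
    using assms unfolding arc_between_def by blast
  note sp = arc_imp_simple_path[OF g(1)]
  show "compact A" "connected A"
    using g compact_arc_image connected_arc_image by blast+
  show "connected (A - {a, b})" "A - {a, b} \<noteq> {}"
    using connected_simple_path_endless[OF sp] nonempty_simple_path_endless[OF sp] g by auto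
  show "a \<in> A" "b \<in> A"
    using g pathstart_in_path_image[of g] pathfinish_in_path_image[of g] by auto
qed

lemma closed_curve_of_arcs:
  assumes A: "arc_between a b A" and B: "arc_between a b B" and AB: "A \<inter> B = {a, b}"
  obtains c where "simple_path c" "pathfinish c = pathstart c" "path_image c = A \<union> B"
proof -
  obtain g where g: "arc g" "pathstart g = a" "pathfinish g = b" "path_image g = A"
    using A unfolding arc_between_def by blast
  obtain h where h: "arc h" "pathstart h = a" "pathfinish h = b" "path_image h = B"
    using B unfolding arc_between_def by blast
  show ?thesis
  proof (rule that[of "g +++ reversepath h"])
    show "simple_path (g +++ reversepath h)"
      using g h AB by (intro simple_path_join_loop) (auto simp: arc_reversepath)
    show "pathfinish (g +++ reversepath h) = pathstart (g +++ reversepath h)"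
      using g h by simp
    show "path_image (g +++ reversepath h) = A \<union> B"
      using g h by (simp add: path_image_join)
  qed
qed

lemma Jordan_two_arcs:
  assumes "arc_between a b A" and "arc_between a b B" and "A \<inter> B = {a, b}"
  shows "inside (A \<union> B) \<noteq> {}" "connected (inside (A \<union> B))"
    "connected (outside (A \<union> B))" "\<not> bounded (outside (A \<union> B))"
    "frontier (inside (A \<union> B)) = A \<union> B" "frontier (outside (A \<union> B)) = A \<union> B"
  using closed_curve_of_arcs[OF assms] Jordan_inside_outside by metis+

lemma third_arc_inside_or_outside:
  assumes C: "arc_between a b C" and AC: "A \<inter> C = {a, b}" and BC: "B \<inter> C = {a, b}"
  shows "C - {a, b} \<subseteq> inside (A \<union> B) \<or> C - {a, b} \<subseteq> outside (A \<union> B)"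
proof -
  have "(A \<union> B) \<inter> (C - {a, b}) = {}" using AC BC by blast
  then have "inside (A \<union> B) \<inter> (C - {a, b}) = {} \<or> outside (A \<union> B) \<inter> (C - {a, b}) = {}"
    using inside_outside_intersect_connected[OF arc_between_props(3)[OF C]] by blast
  moreover have "C - {a, b} \<subseteq> inside (A \<union> B) \<union> outside (A \<union> B)"
    using AC BC inside_Un_outside[of "A \<union> B"] by blast
  ultimately show ?thesis by blast
qed

text \<open>Neither cycle is met by the inside of the other, so each inside is a component of the complement
  of the whole theta curve. If the two components met they would coincide, and so would their
  boundaries \<open>A \<union> B\<close> and \<open>A \<union> C\<close>, although \<open>B\<close> and \<open>C\<close> differ.\<close>

lemma insides_disjoint:
  assumes A: "arc_between a b A" and B: "arc_between a b B" and C: "arc_between a b C"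
    and AB: "A \<inter> B = {a, b}" and AC: "A \<inter> C = {a, b}" and BC: "B \<inter> C = {a, b}"
    and Bout: "B - {a, b} \<subseteq> outside (A \<union> C)" and Cout: "C - {a, b} \<subseteq> outside (A \<union> B)"
  shows "inside (A \<union> B) \<inter> inside (A \<union> C) = {}"
proof (rule ccontr)
  assume ne: "inside (A \<union> B) \<inter> inside (A \<union> C) \<noteq> {}"
  have sub: "inside (A \<union> X) \<subseteq> inside (A \<union> Y)"
    if X: "arc_between a b X" "A \<inter> X = {a, b}" and Y: "A \<inter> Y = {a, b}"
      and out: "Y - {a, b} \<subseteq> outside (A \<union> X)"
      and meet: "inside (A \<union> X) \<inter> inside (A \<union> Y) \<noteq> {}" for X Y
  proof -
    have "inside (A \<union> X) \<inter> (A \<union> Y) = {}"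
      using out Y inside_no_overlap[of "A \<union> X"] inside_Int_outside[of "A \<union> X"] by blast
    then have "outside (A \<union> Y) \<inter> inside (A \<union> X) = {}"
      using inside_outside_intersect_connected[OF Jordan_two_arcs(2)[OF A X]] meet by blast
    then show ?thesis
      using \<open>inside (A \<union> X) \<inter> (A \<union> Y) = {}\<close> inside_Un_outside[of "A \<union> Y"] by blast
  qed
  have "inside (A \<union> B) = inside (A \<union> C)"
    using sub[OF B AB AC Cout ne] sub[OF C AC AB Bout] ne by blast
  then have "A \<union> B = A \<union> C"
    using Jordan_two_arcs(5)[OF A B AB] Jordan_two_arcs(5)[OF A C AC] by metis
  then have "B - {a, b} = {}" using AB BC by blast
  then show False using arc_between_props(4)[OF B] by blast
qed

text \<open>Suppose that each arc runs outside the cycle formed by the other two. Take \<open>x\<close> inside \<open>A \<union> B\<close>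
  and \<open>y\<close> in the unbounded face. By disjointness of the insides \<open>x\<close> is outside \<open>A \<union> C\<close> and outside
  \<open>B \<union> C\<close>, so neither of these two sets separates \<open>x\<close> from \<open>y\<close>. Their intersection is the connected
  set \<open>C\<close>, hence by Janiszewski's theorem their union does not separate the points either. But
  the union contains \<open>A \<union> B\<close>, which does.\<close>

lemma theta_middle_arc:
  assumes A: "arc_between a b A" and B: "arc_between a b B" and C: "arc_between a b C"
    and AB: "A \<inter> B = {a, b}" and AC: "A \<inter> C = {a, b}" and BC: "B \<inter> C = {a, b}"
  shows "A - {a, b} \<subseteq> inside (B \<union> C) \<or> B - {a, b} \<subseteq> inside (A \<union> C) \<or>
    C - {a, b} \<subseteq> inside (A \<union> B)"
proof (rule ccontr)
  assume neg: "\<not> ?thesis"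
  have Aout: "A - {a, b} \<subseteq> outside (B \<union> C)"
    using third_arc_inside_or_outside[OF A, of B C] AB AC neg by blast
  have Bout: "B - {a, b} \<subseteq> outside (A \<union> C)"
    using third_arc_inside_or_outside[OF B, of A C] AB BC neg by blast
  have Cout: "C - {a, b} \<subseteq> outside (A \<union> B)"
    using third_arc_inside_or_outside[OF C, of A B] AC BC neg by blast
  have BA: "B \<inter> A = {a, b}" using AB by blast
  obtain x where x: "x \<in> inside (A \<union> B)" using Jordan_two_arcs(1)[OF A B AB] by blast
  have "compact (A \<union> B \<union> C)"
    using arc_between_props(1) A B C by blast
  then obtain y where y: "y \<in> outside (A \<union> B \<union> C)"
    using outside_bounded_nonempty compact_imp_bounded by blast
  have comp: "connected_component (- (X \<union> C)) x y"
    if "arc_between a b X" "X \<inter> C = {a, b}" "x \<notin> inside (X \<union> C)" "x \<notin> X \<union> C" "X \<subseteq> A \<union> B" for X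
  proof -
    have "x \<in> outside (X \<union> C)" using that(3,4) inside_Un_outside[of "X \<union> C"] by blast
    moreover have "y \<in> outside (X \<union> C)"
      using y outside_mono[of "X \<union> C" "A \<union> B \<union> C"] that(5) by blast
    moreover have "outside (X \<union> C) \<subseteq> - (X \<union> C)"
      by (metis inside_Un_outside sup.cobounded2)
    ultimately show ?thesis
      using Jordan_two_arcs(3)[OF that(1) C that(2)] unfolding connected_component_def by blast
  qed
  have xA: "x \<notin> inside (A \<union> C)"
    using insides_disjoint[OF A B C AB AC BC Bout Cout] x by blast
  have xB: "x \<notin> inside (B \<union> C)"
    using insides_disjoint[OF B A C BA BC AC Aout] Cout x by (metis Int_iff Un_commute empty_iff)
  have xno: "x \<notin> A" "x \<notin> B" "x \<notin> C"
    using x inside_no_overlap[of "A \<union> B"] inside_Int_outside[of "A \<union> B"] Cout AC by blast+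
  have "connected_component (- ((A \<union> C) \<union> (B \<union> C))) x y"
  proof (rule Janiszewski)
    show "compact (A \<union> C)" "closed (B \<union> C)"
      using arc_between_props(1) A B C compact_imp_closed by blast+
    have "(A \<union> C) \<inter> (B \<union> C) = C" using AB AC by blast
    then show "connected ((A \<union> C) \<inter> (B \<union> C))" using arc_between_props(2)[OF C] by simp
  qed (use comp[OF A AC xA] comp[OF B BC xB] xno in auto)
  then have "connected_component (- (A \<union> B)) x y"
    by (rule connected_component_of_subset) auto
  then have "y \<in> inside (A \<union> B)" using x by (rule inside_same_component)
  moreover have "y \<in> outside (A \<union> B)" using y outside_mono[of "A \<union> B" "A \<union> B \<union> C"] by blast
  ultimately show False using inside_Int_outside[of "A \<union> B"] by blast
qed

lemma inside_avoids_closure_outside: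
  fixes S T :: "complex set"
  assumes "closed T" "T \<subseteq> S" 
  shows "inside T \<inter> closure (outside S) = {}"
proof -
  have "inside T \<inter> outside T = {}" by simp
  then have "inside T \<inter> closure (outside T) = {}"
    using open_Int_closure_eq_empty[OF open_inside[OF assms(1)]] by simp
  then show ?thesis using closure_mono[OF outside_mono[OF assms(2)]] by blast
qed

text \<open>This is how the condition on the outer face is used: an arc with an interior point in
  the closure of the outer face cannot be the middle arc of a theta curve.\<close>

lemma third_arc_inside_if_two_outer:
  assumes A: "arc_between a b A" and B: "arc_between a b B" and C: "arc_between a b C"
    and AB: "A \<inter> B = {a, b}" and AC: "A \<inter> C = {a, b}" and BC: "B \<inter> C = {a, b}"
    and S: "A \<union> B \<union> C \<subseteq> S"
    and outer: "(A - {a, b}) \<inter> closure (outside S) \<noteq> {}" "(B - {a, b}) \<inter> closure (outside S) \<noteq> {}"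
  shows "C - {a, b} \<subseteq> inside (A \<union> B)"
proof -
  have cl: "closed A" "closed B" "closed C"
    using arc_between_props(1) A B C compact_imp_closed by blast+
  have "\<not> A - {a, b} \<subseteq> inside (B \<union> C)" "\<not> B - {a, b} \<subseteq> inside (A \<union> C)"
    using inside_avoids_closure_outside[of "B \<union> C" S] inside_avoids_closure_outside[of "A \<union> C" S]
      cl S outer by (simp_all add: closed_Un) blast+
  then show ?thesis using theta_middle_arc[OF A B C AB AC BC] by blast
qed

text \<open>Drawing additional things inside a closed curve does not change its outer face.\<close>

lemma outside_add_inner_set:
  assumes conn: "connected (outside T)" and unb: "\<not> bounded (outside T)" and D: "D \<subseteq> T \<union> inside T"
  shows "outside T \<subseteq> outside (T \<union> D)"
proof
  fix x assume x: "x \<in> outside T"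
  have sub: "outside T \<subseteq> - (T \<union> D)" using D by (auto simp: outside_inside)
  then have "outside T \<subseteq> connected_component_set (- (T \<union> D)) x"
    using connected_component_maximal[OF x conn] by blast
  then show "x \<in> outside (T \<union> D)"
    using unb bounded_subset unfolding outside by blast
qed

section \<open>Drawn paths\<close>

text \<open>Paths and cycles are vertex lists. Working with the set of edges that a list traverses makes
  reversal and concatenation of paths set identities.\<close>

fun path_edges :: "'a list \<Rightarrow> 'a set set" where
  "path_edges (x # y # zs) = insert {x, y} (path_edges (y # zs))"
| "path_edges _ = {}"

lemma Union_path_edges: "\<Union> (path_edges xs) \<subseteq> set xs"
proof (induction xs rule: path_edges.induct)
  case (1 x y zs)
  then show ?case unfolding path_edges.simps by auto
qed simp_all

lemma Union_path_edges_eq: "2 \<le> length xs \<Longrightarrow> \<Union> (path_edges xs) = set xs"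
proof (induction xs rule: path_edges.induct)
  case (1 x y zs)
  then show ?case by (cases zs) auto
qed simp_all

lemma path_edges_append: "path_edges (xs @ y # ys) = path_edges (xs @ [y]) \<union> path_edges (y # ys)"
  by (induction xs rule: path_edges.induct) simp_all

lemma path_edges_Cons_append:
  "path_edges (x # xs @ y # ys) = path_edges (x # xs @ [y]) \<union> path_edges (y # ys)"
  using path_edges_append[of "x # xs" y ys] by simp

lemma path_edges_rev: "path_edges (rev xs) = path_edges xs"
proof (induction xs rule: path_edges.induct)
  case (1 x y zs)
  have "path_edges (rev (x # y # zs)) = path_edges (rev (y # zs)) \<union> {{y, x}}"
    using path_edges_append[of "rev zs" y "[x]"] by simp
  then show ?case unfolding 1 by (simp add: insert_commute[of y x])
qed simp_all

text \<open>Needed to see that two internally disjoint paths with the same ends share no edge: the only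
  candidate is the edge joining the ends.\<close>

lemma ends_not_path_edge:
  assumes "distinct (a # us @ [b])" and "us \<noteq> []"
  shows "{a, b} \<notin> path_edges (a # us @ [b])"
proof -
  obtain u vs where us: "us = u # vs" using assms(2) by (cases us) auto
  have "a \<notin> \<Union> (path_edges (u # vs @ [b]))"
    using Union_path_edges[of "u # vs @ [b]"] assms(1) us by auto
  then show ?thesis using assms(1) us by (auto simp: doubleton_eq_iff)
qed

lemma arc_between_sym: "arc_between a b A \<Longrightarrow> arc_between b a A"
  unfolding arc_between_def
  by (metis arc_reversepath path_image_reversepath pathfinish_reversepath pathstart_reversepath)

lemma arc_between_join:
  assumes "arc_between a b A" and "arc_between b c B" and "A \<inter> B \<subseteq> {b}"
  shows "arc_between a c (A \<union> B)"
proof -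
  obtain g where g: "arc g" "pathstart g = a" "pathfinish g = b" "path_image g = A"
    using assms(1) unfolding arc_between_def by blast
  obtain h where h: "arc h" "pathstart h = b" "pathfinish h = c" "path_image h = B"
    using assms(2) unfolding arc_between_def by blast
  have "arc (g +++ h)" using g h assms(3) by (intro arc_join) auto
  then show ?thesis
    unfolding arc_between_def using g h by (intro exI[of _ "g +++ h"]) (simp add: path_image_join)
qed

definition drawn :: "('a set \<Rightarrow> real \<Rightarrow> complex) \<Rightarrow> 'a list \<Rightarrow> complex set" where
  "drawn \<gamma> xs = (\<Union>e \<in> path_edges xs. path_image (\<gamma> e))"

lemma drawn_simps:
  "drawn \<gamma> (x # y # zs) = path_image (\<gamma> {x, y}) \<union> drawn \<gamma> (y # zs)"
  by (simp add: drawn_def)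

lemma drawn_Cons_append:
  "drawn \<gamma> (x # xs @ y # ys) = drawn \<gamma> (x # xs @ [y]) \<union> drawn \<gamma> (y # ys)"
  unfolding drawn_def path_edges_Cons_append[of x xs y ys] by blast

lemma drawn_rev: "drawn \<gamma> (rev xs) = drawn \<gamma> xs"
  by (simp add: drawn_def path_edges_rev)

locale drawing =
  fixes G :: "'a sgraph" and p \<gamma>
  assumes simple: "simple_graph G" and drawing: "plane_drawing G p \<gamma>"
begin

lemma p_eq_iff: "\<lbrakk>u \<in> verts G; v \<in> verts G\<rbrakk> \<Longrightarrow> p u = p v \<longleftrightarrow> u = v"
  using drawing unfolding plane_drawing_def by (auto dest: inj_onD)

lemma edge_subset_verts: "e \<in> edges G \<Longrightarrow> e \<subseteq> verts G"
  using simple unfolding simple_graph_def by blast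

lemma edge_arc: "{x, y} \<in> edges G \<Longrightarrow> arc_between (p x) (p y) (path_image (\<gamma> {x, y}))"
proof -
  assume e: "{x, y} \<in> edges G"
  then have "arc (\<gamma> {x, y})" and
    ends: "{pathstart (\<gamma> {x, y}), pathfinish (\<gamma> {x, y})} = {p x, p y}"
    using drawing unfolding plane_drawing_def by auto
  then show ?thesis
    using arc_between_sym[of "p y" "p x"] unfolding arc_between_def doubleton_eq_iff by blast
qed

lemma edges_meet:
  "\<lbrakk>e \<in> edges G; f \<in> edges G; e \<noteq> f\<rbrakk> \<Longrightarrow>
    path_image (\<gamma> e) \<inter> path_image (\<gamma> f) \<subseteq> p ` (e \<inter> f)"
  using drawing unfolding plane_drawing_def by simp

lemma drawn_meet:
  assumes "path_edges xs \<subseteq> edges G" and "path_edges ys \<subseteq> edges G"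
    and "path_edges xs \<inter> path_edges ys = {}"
  shows "drawn \<gamma> xs \<inter> drawn \<gamma> ys \<subseteq> p ` (set xs \<inter> set ys)"
proof
  fix z assume "z \<in> drawn \<gamma> xs \<inter> drawn \<gamma> ys"
  then obtain e f where ef: "e \<in> path_edges xs" "f \<in> path_edges ys"
    and z: "z \<in> path_image (\<gamma> e) \<inter> path_image (\<gamma> f)"
    unfolding drawn_def by blast
  moreover have "e \<in> edges G" "f \<in> edges G" "e \<noteq> f" using ef assms by auto
  ultimately have "z \<in> p ` (e \<inter> f)" using edges_meet[of e f] by (metis subsetD)
  moreover have "e \<inter> f \<subseteq> set xs \<inter> set ys"
    using Union_path_edges[of xs] Union_path_edges[of ys] ef by blast
  ultimately show "z \<in> p ` (set xs \<inter> set ys)" by blast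
qed

lemma arc_between_drawn:
  assumes "distinct (x # xs)" and "xs \<noteq> []" and "path_edges (x # xs) \<subseteq> edges G"
  shows "arc_between (p x) (p (last xs)) (drawn \<gamma> (x # xs))"
  using assms
proof (induction xs arbitrary: x)
  case (Cons y ys)
  show ?case
  proof (cases "ys = []")
    case True
    then show ?thesis using edge_arc[of x y] Cons.prems by (simp add: drawn_def)
  next
    case False
    have rest: "arc_between (p y) (p (last ys)) (drawn \<gamma> (y # ys))"
      using Cons.IH[of y] Cons.prems False by simp
    have "{x, y} \<notin> path_edges (y # ys)"
      using Union_path_edges[of "y # ys"] Cons.prems(1) by auto
    then have "drawn \<gamma> [x, y] \<inter> drawn \<gamma> (y # ys) \<subseteq> p ` (set [x, y] \<inter> set (y # ys))"
      using Cons.prems(3) by (intro drawn_meet) auto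
    then have "path_image (\<gamma> {x, y}) \<inter> drawn \<gamma> (y # ys) \<subseteq> {p y}"
      using Cons.prems(1) by (auto simp: drawn_def)
    then show ?thesis
      using arc_between_join[OF edge_arc rest] Cons.prems(3) False by (simp add: drawn_simps)
  qed
qed simp

lemma vertex_on_drawn:
  assumes "{x, y} \<in> edges G"
  shows "p x \<in> path_image (\<gamma> {x, y})" "p y \<in> path_image (\<gamma> {x, y})"
  using arc_between_props(5,6)[OF edge_arc[OF assms]] by auto

lemma inner_vertex_on_drawn:
  assumes "path_edges (a # us @ [b]) \<subseteq> edges G" and "u \<in> set us"
  shows "p u \<in> drawn \<gamma> (a # us @ [b])"
proof -
  obtain xs ys where us: "us = xs @ u # ys" using split_list[OF assms(2)] by blast
  obtain w ws where w: "ys @ [b] = w # ws" by (cases "ys @ [b]") auto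
  have "{u, w} \<in> path_edges (a # us @ [b])"
    using path_edges_Cons_append[of a xs u "w # ws"] us w by simp
  then show ?thesis using vertex_on_drawn(1)[of u w] assms(1) unfolding drawn_def by blast
qed

lemma drawn_paths_meet:
  assumes dist: "distinct (a # b # us @ vs)" and us: "us \<noteq> []"
    and E: "path_edges (a # us @ [b]) \<subseteq> edges G" "path_edges (a # vs @ [b]) \<subseteq> edges G"
  shows "drawn \<gamma> (a # us @ [b]) \<inter> drawn \<gamma> (a # vs @ [b]) = {p a, p b}"
proof
  have "path_edges (a # us @ [b]) \<inter> path_edges (a # vs @ [b]) = {}"
  proof (rule ccontr)
    assume "\<not> ?thesis"
    then obtain e where e: "e \<in> path_edges (a # us @ [b])" "e \<in> path_edges (a # vs @ [b])" by blast
    have "e \<subseteq> {a, b}"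
      using Union_path_edges[of "a # us @ [b]"] Union_path_edges[of "a # vs @ [b]"] e dist by auto
    moreover have "card e = 2" using e E simple unfolding simple_graph_def by blast
    ultimately have "e = {a, b}" using dist by (intro card_subset_eq) auto
    then show False using ends_not_path_edge[of a us b] e(1) us dist by auto
  qed
  from drawn_meet[OF E this]
  show "drawn \<gamma> (a # us @ [b]) \<inter> drawn \<gamma> (a # vs @ [b]) \<subseteq> {p a, p b}" using dist by auto
  show "{p a, p b} \<subseteq> drawn \<gamma> (a # us @ [b]) \<inter> drawn \<gamma> (a # vs @ [b])"
    using arc_between_props(5,6)[OF arc_between_drawn[of a "us @ [b]"]]
      arc_between_props(5,6)[OF arc_between_drawn[of a "vs @ [b]"]] dist E by auto
qed

text \<open>The transfer of the theta curve argument to paths of the graph. The set \<open>S\<close> may be smaller than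
  the drawing of all of \<open>G\<close>; the argument for crossing chords needs this freedom.\<close>

lemma third_path_inside:
  assumes dist: "distinct (a # b # us @ vs @ ws)"
    and E: "path_edges (a # us @ [b]) \<subseteq> edges G" "path_edges (a # vs @ [b]) \<subseteq> edges G"
      "path_edges (a # ws @ [b]) \<subseteq> edges G"
    and S: "drawn \<gamma> (a # us @ [b]) \<union> drawn \<gamma> (a # vs @ [b]) \<union> drawn \<gamma> (a # ws @ [b]) \<subseteq> S"
    and outer: "u \<in> set us" "p u \<in> closure (outside S)" "v \<in> set vs" "p v \<in> closure (outside S)"
  shows "drawn \<gamma> (a # ws @ [b]) - {p a, p b} \<subseteq>
    inside (drawn \<gamma> (a # us @ [b]) \<union> drawn \<gamma> (a # vs @ [b]))"
proof -
  have arcs: "arc_between (p a) (p b) (drawn \<gamma> (a # us @ [b]))"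
    "arc_between (p a) (p b) (drawn \<gamma> (a # vs @ [b]))"
    "arc_between (p a) (p b) (drawn \<gamma> (a # ws @ [b]))"
    using arc_between_drawn[of a "us @ [b]"] arc_between_drawn[of a "vs @ [b]"]
      arc_between_drawn[of a "ws @ [b]"] dist E by auto
  have ne: "us \<noteq> []" "vs \<noteq> []" using outer by auto
  have meet: "drawn \<gamma> (a # us @ [b]) \<inter> drawn \<gamma> (a # vs @ [b]) = {p a, p b}"
    using dist by (intro drawn_paths_meet E ne) auto
  have meet2: "drawn \<gamma> (a # us @ [b]) \<inter> drawn \<gamma> (a # ws @ [b]) = {p a, p b}"
    using dist by (intro drawn_paths_meet E ne) auto
  have meet3: "drawn \<gamma> (a # vs @ [b]) \<inter> drawn \<gamma> (a # ws @ [b]) = {p a, p b}"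
    using dist by (intro drawn_paths_meet E ne) auto
  have "set (a # us @ [b]) \<subseteq> verts G" "set (a # vs @ [b]) \<subseteq> verts G"
    using Union_path_edges_eq[of "a # us @ [b]"] Union_path_edges_eq[of "a # vs @ [b]"]
      E edge_subset_verts by (metis Sup_le_iff length_Cons length_append_singleton
        numeral_2_eq_2 le_add2 Suc_le_mono le0 subset_iff)+
  then have "p u \<noteq> p a" "p u \<noteq> p b" "p v \<noteq> p a" "p v \<noteq> p b"
    using outer(1,3) dist by (auto simp: p_eq_iff subset_iff)
  then show ?thesis
    using third_arc_inside_if_two_outer[OF arcs meet meet2 meet3 S] outer
      inner_vertex_on_drawn[OF E(1) outer(1)] inner_vertex_on_drawn[OF E(2) outer(3)] by blast
qed

end

section \<open>Obstructions to outerplanarity\<close>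

text \<open>A single edge counts as a cycle with two vertices. Then every graph with an edge has a longest
  cycle, and the argument for Hamiltonian cycles needs no separate treatment of forests.\<close>

definition cycle :: "'a set set \<Rightarrow> 'a list \<Rightarrow> bool" where
  "cycle E xs \<longleftrightarrow> distinct xs \<and> 2 \<le> length xs \<and> path_edges (xs @ [hd xs]) \<subseteq> E"

text \<open>The two obstructions to outerplanarity: a subdivision of \<open>K\<^sub>2\<^sub>,\<^sub>3\<close>, and a cycle with two crossing
  chords, which is a subdivision of \<open>K\<^sub>4\<close> in which two opposite edges are not subdivided.\<close>

definition has_K23_subdivision :: "'a set set \<Rightarrow> bool" where
  "has_K23_subdivision E \<longleftrightarrow>
     (\<exists>a b us vs ws. distinct (a # b # us @ vs @ ws) \<and> us \<noteq> [] \<and> vs \<noteq> [] \<and> ws \<noteq> [] \<and>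
        path_edges (a # us @ [b]) \<subseteq> E \<and> path_edges (a # vs @ [b]) \<subseteq> E \<and>
        path_edges (a # ws @ [b]) \<subseteq> E)"

definition has_crossing_chords :: "'a set set \<Rightarrow> bool" where
  "has_crossing_chords E \<longleftrightarrow>
     (\<exists>a us b vs c ws d zs. cycle E (a # us @ b # vs @ c # ws @ d # zs) \<and>
        {a, c} \<in> E \<and> {b, d} \<in> E)"

context drawing
begin

lemma arc_between_drawn_ends:
  assumes "distinct (a # b # us)" and "path_edges (a # us @ [b]) \<subseteq> edges G"
  shows "arc_between (p a) (p b) (drawn \<gamma> (a # us @ [b]))"
  using arc_between_drawn[of a "us @ [b]"] assms by simp

lemma drawn_subset_image:
  "path_edges xs \<subseteq> edges G \<Longrightarrow> drawn \<gamma> xs \<subseteq> drawing_image G p \<gamma>"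
  unfolding drawn_def drawing_image_def by blast

text \<open>Each of the three paths has an inner vertex on the boundary of the outer face, so none of them
  can be the middle one.\<close>

lemma no_K23_subdivision:
  assumes outer: "\<And>v. v \<in> verts G \<Longrightarrow> p v \<in> closure (outside (drawing_image G p \<gamma>))"
  shows "\<not> has_K23_subdivision (edges G)"
proof
  assume "has_K23_subdivision (edges G)"
  then obtain a b us vs ws where dist: "distinct (a # b # us @ vs @ ws)"
    and ne: "us \<noteq> []" "vs \<noteq> []" "ws \<noteq> []"
    and E: "path_edges (a # us @ [b]) \<subseteq> edges G" "path_edges (a # vs @ [b]) \<subseteq> edges G"
      "path_edges (a # ws @ [b]) \<subseteq> edges G"
    unfolding has_K23_subdivision_def by blast
  let ?S = "drawing_image G p \<gamma>"
  have inner: "hd us \<in> set us" "hd vs \<in> set vs" "hd ws \<in> set ws" using ne by auto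
  have sub: "set (a # xs @ [b]) \<subseteq> verts G" if "path_edges (a # xs @ [b]) \<subseteq> edges G" for xs
    using Union_path_edges_eq[of "a # xs @ [b]"] that edge_subset_verts by fastforce
  have verts: "set (a # b # us @ vs @ ws) \<subseteq> verts G"
    using sub[OF E(1)] sub[OF E(2)] sub[OF E(3)] by auto
  have "drawn \<gamma> (a # ws @ [b]) - {p a, p b} \<subseteq>
      inside (drawn \<gamma> (a # us @ [b]) \<union> drawn \<gamma> (a # vs @ [b]))"
  proof (rule third_path_inside[OF dist E _ inner(1) _ inner(2)])
    show "drawn \<gamma> (a # us @ [b]) \<union> drawn \<gamma> (a # vs @ [b]) \<union> drawn \<gamma> (a # ws @ [b]) \<subseteq> ?S"
      using E drawn_subset_image by blast
  qed (use outer verts inner in auto)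
  moreover have "p (hd ws) \<in> drawn \<gamma> (a # ws @ [b]) - {p a, p b}"
    using inner_vertex_on_drawn[OF E(3) inner(3)] dist verts inner(3)
    by (auto simp: p_eq_iff subset_iff)
  moreover have "p (hd ws) \<in> closure (outside ?S)" using outer verts inner by auto
  moreover have "closed (drawn \<gamma> (a # us @ [b]) \<union> drawn \<gamma> (a # vs @ [b]))"
    using arc_between_props(1)[OF arc_between_drawn[of a "us @ [b]"]]
      arc_between_props(1)[OF arc_between_drawn[of a "vs @ [b]"]] dist E
    by (intro closed_Un compact_imp_closed) auto
  moreover have "drawn \<gamma> (a # us @ [b]) \<union> drawn \<gamma> (a # vs @ [b]) \<subseteq> ?S"
    using E drawn_subset_image by blast
  ultimately show False using inside_avoids_closure_outside by blast
qed

text \<open>Let \<open>T\<close> be the drawn cycle. Each chord forms a theta curve with \<open>T\<close> whose other two arcs carry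
  outer vertices, so both chords run inside \<open>T\<close>. Hence \<open>T\<close> together with the chords \<open>D\<close> has the same
  outer face as \<open>T\<close>, and every point of \<open>T\<close>, not only a vertex, lies on the boundary of that face.
  Now consider the three paths from \<open>a\<close> to \<open>b\<close> given by the part of the cycle between them, by
  the chord \<open>a c\<close> and the part from \<open>c\<close> to \<open>b\<close>, and by the part from \<open>a\<close> to \<open>d\<close> and the chord \<open>d b\<close>.
  All three have interior points on the outer boundary, so none can be the middle one.\<close>

lemma no_crossing_chords:
  assumes outer: "\<And>v. v \<in> verts G \<Longrightarrow> p v \<in> closure (outside (drawing_image G p \<gamma>))"
  shows "\<not> has_crossing_chords (edges G)"
proof
  assume "has_crossing_chords (edges G)"
  then obtain a us b vs c ws d zs
    where cyc: "cycle (edges G) (a # us @ b # vs @ c # ws @ d # zs)"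
      and chords: "{a, c} \<in> edges G" "{b, d} \<in> edges G"
    unfolding has_crossing_chords_def by blast
  then have dist: "distinct (a # us @ b # vs @ c # ws @ d # zs)"
    and E: "path_edges (a # us @ b # vs @ c # ws @ d # zs @ [a]) \<subseteq> edges G"
    unfolding cycle_def by auto
  define ab bc cd da where "ab = a # us @ [b]" and "bc = b # vs @ [c]" and "cd = c # ws @ [d]"
    and "da = d # zs @ [a]"
  have glue: "path_edges (x # (ys @ y # zs) @ [z]) = path_edges (x # ys @ [y]) \<union> path_edges (y # zs @ [z])"
    "drawn \<gamma> (x # (ys @ y # zs) @ [z]) = drawn \<gamma> (x # ys @ [y]) \<union> drawn \<gamma> (y # zs @ [z])"
    for x y z :: 'a and ys zs
    using path_edges_Cons_append[of x ys y "zs @ [z]"] drawn_Cons_append[of \<gamma> x ys y "zs @ [z]"]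
    by simp_all
  have parts: "path_edges ab \<subseteq> edges G" "path_edges bc \<subseteq> edges G"
     "path_edges cd \<subseteq> edges G" "path_edges da \<subseteq> edges G"
    using E path_edges_Cons_append[of a us b "vs @ c # ws @ d # zs @ [a]"]
      path_edges_Cons_append[of b vs c "ws @ d # zs @ [a]"]
      path_edges_Cons_append[of c ws d "zs @ [a]"]
    unfolding ab_def bc_def cd_def da_def by simp_all
  have rev1: "path_edges (a # rev zs @ [d]) = path_edges da" "drawn \<gamma> (a # rev zs @ [d]) = drawn \<gamma> da"
    "path_edges (d # rev ws @ [c]) = path_edges cd" "drawn \<gamma> (d # rev ws @ [c]) = drawn \<gamma> cd"
    "path_edges (c # rev vs @ [b]) = path_edges bc" "drawn \<gamma> (c # rev vs @ [b]) = drawn \<gamma> bc"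
    "path_edges (b # rev us @ [a]) = path_edges ab" "drawn \<gamma> (b # rev us @ [a]) = drawn \<gamma> ab"
    using path_edges_rev[of da] path_edges_rev[of cd] path_edges_rev[of bc] path_edges_rev[of ab]
      drawn_rev[of \<gamma> da] drawn_rev[of \<gamma> cd] drawn_rev[of \<gamma> bc] drawn_rev[of \<gamma> ab]
    unfolding ab_def bc_def cd_def da_def by simp_all
  have verts: "set (a # us @ b # vs @ c # ws @ d # zs) \<subseteq> verts G"
    using Union_path_edges_eq[of "a # us @ b # vs @ c # ws @ d # zs @ [a]"] E edge_subset_verts
    by fastforce
  define T where "T = drawn \<gamma> ab \<union> drawn \<gamma> bc \<union> drawn \<gamma> cd \<union> drawn \<gamma> da"
  define D where "D = drawn \<gamma> [a, c] \<union> drawn \<gamma> [b, d]"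
  have "T \<union> D \<subseteq> drawing_image G p \<gamma>"
    unfolding T_def D_def using parts chords drawn_subset_image[of ab] drawn_subset_image[of bc]
      drawn_subset_image[of cd] drawn_subset_image[of da] drawn_subset_image[of "[a, c]"]
      drawn_subset_image[of "[b, d]"] by auto
  then have outer': "p v \<in> closure (outside (T \<union> D))" if "v \<in> verts G" for v
    using outer[OF that] closure_mono[OF outside_mono] by blast
  note folds = ab_def[symmetric] bc_def[symmetric] cd_def[symmetric] da_def[symmetric]
  have abc: "path_edges (a # (us @ b # vs) @ [c]) \<subseteq> edges G"
    "drawn \<gamma> (a # (us @ b # vs) @ [c]) = drawn \<gamma> ab \<union> drawn \<gamma> bc"
    unfolding glue folds using parts by auto
  have bcd: "path_edges (b # (vs @ c # ws) @ [d]) \<subseteq> edges G"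
    "drawn \<gamma> (b # (vs @ c # ws) @ [d]) = drawn \<gamma> bc \<union> drawn \<gamma> cd"
    unfolding glue folds using parts by auto
  have adc: "path_edges (a # (rev zs @ d # rev ws) @ [c]) \<subseteq> edges G"
    "drawn \<gamma> (a # (rev zs @ d # rev ws) @ [c]) = drawn \<gamma> da \<union> drawn \<gamma> cd"
    unfolding glue rev1 using parts by auto
  have bad: "path_edges (b # (rev us @ a # rev zs) @ [d]) \<subseteq> edges G"
    "drawn \<gamma> (b # (rev us @ a # rev zs) @ [d]) = drawn \<gamma> ab \<union> drawn \<gamma> da"
    unfolding glue rev1 using parts by auto
  have acb: "path_edges (a # ([] @ c # rev vs) @ [b]) \<subseteq> edges G"
    "drawn \<gamma> (a # ([] @ c # rev vs) @ [b]) = drawn \<gamma> [a, c] \<union> drawn \<gamma> bc"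
    unfolding glue rev1 using parts chords by auto
  have adb: "path_edges (a # (rev zs @ d # []) @ [b]) \<subseteq> edges G"
    "drawn \<gamma> (a # (rev zs @ d # []) @ [b]) = drawn \<gamma> da \<union> drawn \<gamma> [b, d]"
    unfolding glue rev1 using parts chords drawn_rev[of \<gamma> "[b, d]"] by (auto simp: insert_commute)
  \<comment> \<open>Both chords run inside the cycle.\<close>
  have ac: "drawn \<gamma> [a, c] - {p a, p c} \<subseteq> inside T"
  proof -
    have "drawn \<gamma> (a # [] @ [c]) - {p a, p c} \<subseteq>
      inside (drawn \<gamma> (a # (us @ b # vs) @ [c]) \<union> drawn \<gamma> (a # (rev zs @ d # rev ws) @ [c]))"
    proof (rule third_path_inside[OF _ abc(1) adc(1), where u = b and v = d and S = "T \<union> D"])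
      show "drawn \<gamma> (a # (us @ b # vs) @ [c]) \<union> drawn \<gamma> (a # (rev zs @ d # rev ws) @ [c]) \<union>
          drawn \<gamma> (a # [] @ [c]) \<subseteq> T \<union> D"
        unfolding abc(2) adc(2) T_def D_def by auto
    qed (use dist chords verts outer' in auto)
    then show ?thesis unfolding abc(2) adc(2) T_def by (simp add: Un_ac)
  qed
  have bd: "drawn \<gamma> [b, d] - {p b, p d} \<subseteq> inside T"
  proof -
    have "drawn \<gamma> (b # [] @ [d]) - {p b, p d} \<subseteq>
      inside (drawn \<gamma> (b # (vs @ c # ws) @ [d]) \<union> drawn \<gamma> (b # (rev us @ a # rev zs) @ [d]))"
    proof (rule third_path_inside[OF _ bcd(1) bad(1), where u = c and v = a and S = "T \<union> D"])
      show "drawn \<gamma> (b # (vs @ c # ws) @ [d]) \<union> drawn \<gamma> (b # (rev us @ a # rev zs) @ [d]) \<union>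
          drawn \<gamma> (b # [] @ [d]) \<subseteq> T \<union> D"
        unfolding bcd(2) bad(2) T_def D_def by auto
    qed (use dist chords verts outer' in auto)
    then show ?thesis unfolding bcd(2) bad(2) T_def by (simp add: Un_ac)
  qed
  have T: "T = drawn \<gamma> (a # (us @ b # vs) @ [c]) \<union> drawn \<gamma> (a # (rev zs @ d # rev ws) @ [c])"
    unfolding abc(2) adc(2) T_def by blast
  have arc_abc: "arc_between (p a) (p c) (drawn \<gamma> (a # (us @ b # vs) @ [c]))"
    by (rule arc_between_drawn_ends[OF _ abc(1)]) (use dist in auto)
  have arc_adc: "arc_between (p a) (p c) (drawn \<gamma> (a # (rev zs @ d # rev ws) @ [c]))"
    by (rule arc_between_drawn_ends[OF _ adc(1)]) (use dist in auto)
  have meet: "drawn \<gamma> (a # (us @ b # vs) @ [c]) \<inter> drawn \<gamma> (a # (rev zs @ d # rev ws) @ [c])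
      = {p a, p c}"
    using dist by (intro drawn_paths_meet abc adc) auto
  note J = Jordan_two_arcs[OF arc_abc arc_adc meet, folded T]
  have arc_ab: "arc_between (p a) (p b) (drawn \<gamma> ab)"
    unfolding ab_def using parts(1) dist by (intro arc_between_drawn_ends) (auto simp: ab_def)
  have p_T: "p a \<in> T" "p b \<in> T" "p c \<in> T" "p d \<in> T"
    using arc_between_props(5,6)[OF arc_ab] arc_between_props(5,6)[OF arc_between_drawn_ends[of c d ws]]
      dist parts unfolding T_def cd_def by auto
  have "outside T \<subseteq> outside (T \<union> D)"
    using ac bd p_T unfolding D_def by (intro outside_add_inner_set J(3,4)) auto
  moreover have "T \<subseteq> closure (outside T)"
    using J(6) frontier_def by auto
  ultimately have TD: "T \<subseteq> closure (outside (T \<union> D))" using closure_mono by blast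
  \<comment> \<open>The second and third path from \<open>a\<close> to \<open>b\<close>; the first one would have to lie inside the curve that they form.\<close>
  define U where "U = drawn \<gamma> (a # ([] @ c # rev vs) @ [b]) \<union> drawn \<gamma> (a # (rev zs @ d # []) @ [b])"
  have U: "U \<subseteq> T \<union> D" unfolding U_def acb(2) adb(2) T_def D_def by blast
  have "drawn \<gamma> (a # us @ [b]) - {p a, p b} \<subseteq> inside U"
    unfolding U_def
  proof (rule third_path_inside[OF _ acb(1) adb(1), where u = c and v = d and S = "T \<union> D"])
    show "drawn \<gamma> (a # ([] @ c # rev vs) @ [b]) \<union> drawn \<gamma> (a # (rev zs @ d # []) @ [b]) \<union>
          drawn \<gamma> (a # us @ [b]) \<subseteq> T \<union> D"
      using U unfolding U_def T_def folds by blast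
  qed (use dist parts verts outer' ab_def in auto)
  then have "drawn \<gamma> ab - {p a, p b} \<subseteq> inside U" by (simp add: ab_def)
  moreover have "drawn \<gamma> ab - {p a, p b} \<subseteq> closure (outside (T \<union> D))"
    using TD T_def by blast
  moreover have "closed U"
    unfolding U_def
    by (intro closed_Un compact_imp_closed arc_between_props(1)[OF arc_between_drawn_ends] acb(1) adb(1))
      (use dist in auto)
  ultimately show False
    using inside_avoids_closure_outside[OF _ U] arc_between_props(4)[OF arc_ab] by blast
qed

end

lemma outerplanar_no_obstruction:
  assumes "outerplanar G"
  shows "\<not> has_K23_subdivision (edges G)" "\<not> has_crossing_chords (edges G)"
proof -
  obtain p \<gamma> where "simple_graph G" "plane_drawing G p \<gamma>"
    and outer: "\<forall>v \<in> verts G. p v \<in> frontier (outside (drawing_image G p \<gamma>))"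
    using assms unfolding outerplanar_def by blast
  then interpret drawing G p \<gamma> by unfold_locales
  have "p v \<in> closure (outside (drawing_image G p \<gamma>))" if "v \<in> verts G" for v
    using outer that unfolding frontier_def by blast
  then show "\<not> has_K23_subdivision (edges G)" "\<not> has_crossing_chords (edges G)"
    using no_K23_subdivision no_crossing_chords by blast+
qed

section \<open>Noncrossing vertex orders\<close>

text \<open>Placing the vertices on a circle in the order \<open>xs\<close>, no two edges cross as straight chords.\<close>

definition noncrossing :: "'a set set \<Rightarrow> 'a list \<Rightarrow> bool" where
  "noncrossing E xs \<longleftrightarrow> distinct xs \<and>
     (\<forall>i j k l. i < j \<longrightarrow> j < k \<longrightarrow> k < l \<longrightarrow> l < length xs \<longrightarrow>
        \<not> ({xs ! i, xs ! k} \<in> E \<and> {xs ! j, xs ! l} \<in> E))"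

lemma noncrossingD:
  "\<lbrakk>noncrossing E xs; i < j; j < k; k < l; l < length xs; {xs ! i, xs ! k} \<in> E\<rbrakk>
    \<Longrightarrow> {xs ! j, xs ! l} \<notin> E"
  unfolding noncrossing_def by blast

text \<open>Crossing depends only on the cyclic order.\<close>

lemma noncrossing_rotate1:
  assumes "noncrossing E xs" shows "noncrossing E (rotate1 xs)"
proof (cases xs)
  case (Cons x ys)
  have "False" if ijkl: "i < j" "j < k" "k < l" "l < Suc (length ys)"
    and E: "{(ys @ [x]) ! i, (ys @ [x]) ! k} \<in> E" "{(ys @ [x]) ! j, (ys @ [x]) ! l} \<in> E"
  for i j k l
  proof (cases "l < length ys")
    case True
    then show False
      using noncrossingD[OF assms, of "Suc i" "Suc j" "Suc k" "Suc l"] ijkl E Cons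
      by (simp add: nth_append)
  next
    case False
    then have "l = length ys" using ijkl by simp
    then show False
      using noncrossingD[OF assms, of 0 "Suc i" "Suc j" "Suc k"] ijkl E Cons
      by (simp add: nth_append insert_commute)
  qed
  then show ?thesis using assms Cons unfolding noncrossing_def by auto
qed (use assms in simp)

lemma noncrossing_swap:
  assumes "noncrossing E (xs @ ys)" shows "noncrossing E (ys @ xs)"
proof -
  have "noncrossing E (rotate n (xs @ ys))" for n
    using assms by (induction n) (simp_all add: noncrossing_rotate1)
  from this[of "length xs"] show ?thesis by (simp add: rotate_append)
qed

text \<open>The list \<open>vs\<close> is empty or consists of a cut vertex. An edge within the left part and an edge within
  the right part cannot cross, since their ranges of positions share at most one position.\<close>

lemma noncrossing_glue:
  assumes L: "noncrossing E (xs @ vs)" and R: "noncrossing E (vs @ ys)"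
    and dist: "distinct (xs @ vs @ ys)" and vs: "length vs \<le> 1"
    and E: "\<And>e. e \<in> E \<Longrightarrow> e \<subseteq> set (xs @ vs) \<or> e \<subseteq> set (vs @ ys)"
  shows "noncrossing E (xs @ vs @ ys)"
proof -
  let ?zs = "xs @ vs @ ys"
  let ?n = "length xs" and ?m = "length xs + length vs"
  have left: "i < ?m" if "?zs ! i \<in> set (xs @ vs)" "i < length ?zs" for i
  proof (rule ccontr)
    assume "\<not> i < ?m"
    then have "?zs ! i \<in> set ys" using that(2) by (auto simp: nth_append)
    then show False using that(1) dist by auto
  qed
  have right: "?n \<le> i" if "?zs ! i \<in> set (vs @ ys)" "i < length ?zs" for i
  proof (rule ccontr)
    assume "\<not> ?n \<le> i"
    then have "?zs ! i \<in> set xs" by (auto simp: nth_append)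
    then show False using that(1) dist by auto
  qed
  have False if ijkl: "i < j" "j < k" "k < l" "l < length ?zs"
    and ik: "{?zs ! i, ?zs ! k} \<in> E" and jl: "{?zs ! j, ?zs ! l} \<in> E" for i j k l
  proof -
    have ik': "k < ?m \<or> ?n \<le> i" using E[OF ik] left[of k] right[of i] ijkl by auto
    have jl': "l < ?m \<or> ?n \<le> j" using E[OF jl] left[of l] right[of j] ijkl by auto
    consider "l < ?m" | "?n \<le> i" using ik' jl' ijkl vs by linarith
    then show False
    proof cases
      case 1
      have "?zs ! t = (xs @ vs) ! t" if "t < ?m" for t
        using that by (metis append.assoc length_append nth_append)
      then show False
        using noncrossingD[OF L ijkl(1-3)] 1 ijkl ik jl by simp
    next
      case 2
      have "?zs ! t = (vs @ ys) ! (t - ?n)" if "?n \<le> t" for t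
        using that by (simp add: nth_append)
      then show False
        using noncrossingD[OF R, of "i - ?n" "j - ?n" "k - ?n" "l - ?n"] 2 ijkl ik jl
        by (simp add: less_diff_conv2 diff_less_mono)
    qed
  qed
  then show ?thesis using dist unfolding noncrossing_def by blast
qed

lemma noncrossing_induced:
  assumes "noncrossing {e \<in> E. e \<subseteq> A} xs" and "set xs = A"
  shows "noncrossing E xs"
  using assms unfolding noncrossing_def
  by (smt (verit, ccfv_threshold) empty_subsetI insert_subset less_trans mem_Collect_eq nth_mem)

lemma cycle_two_paths:
  "cycle E (x # us @ y # vs) \<longleftrightarrow> distinct (x # us @ y # vs) \<and>
     path_edges (x # us @ [y]) \<subseteq> E \<and> path_edges (y # vs @ [x]) \<subseteq> E"
  unfolding cycle_def using path_edges_Cons_append[of x us y "vs @ [x]"] by auto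

lemma cycle_swap:
  assumes "cycle E (xs @ ys)" shows "cycle E (ys @ xs)"
proof (cases "xs = [] \<or> ys = []")
  case True then show ?thesis using assms by auto
next
  case False
  then obtain x us y vs where "xs = x # us" "ys = y # vs" by (meson neq_Nil_conv)
  then show ?thesis using assms cycle_two_paths[of E x us y vs] cycle_two_paths[of E y vs x us] by auto
qed

lemma cycle_through_two:
  assumes C: "cycle E C" and x: "x \<in> set C" and y: "y \<in> set C" and "x \<noteq> y"
  obtains us vs where "cycle E (x # us @ y # vs)" "set (x # us @ y # vs) = set C"
    "length (x # us @ y # vs) = length C"
proof -
  obtain as bs where C1: "C = as @ x # bs" using split_list[OF x] by blast
  have "cycle E ((x # bs) @ as)" using cycle_swap C C1 by blast
  have "y \<in> set (bs @ as)" using y C1 \<open>x \<noteq> y\<close> by auto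
  then obtain us vs where "bs @ as = us @ y # vs" by (meson split_list)
  moreover have "set (x # bs @ as) = set C" "length (x # bs @ as) = length C" using C1 by auto
  ultimately show ?thesis using that \<open>cycle E ((x # bs) @ as)\<close> by auto
qed

text \<open>Translates crossing edges, given by positions, into crossing chords of a cycle.\<close>

lemma four_positions_split:
  assumes "i < j" "j < k" "k < l" "l < length xs"
  obtains as us vs ws zs where "xs = as @ xs ! i # us @ xs ! j # vs @ xs ! k # ws @ xs ! l # zs"
proof -
  have "take l xs = take k (take l xs) @ xs ! k # drop (Suc k) (take l xs)"
    using id_take_nth_drop[of k "take l xs"] assms by simp
  moreover have "take k xs = take j (take k xs) @ xs ! j # drop (Suc j) (take k xs)"
    using id_take_nth_drop[of j "take k xs"] assms by simp
  moreover have "take j xs = take i (take j xs) @ xs ! i # drop (Suc i) (take j xs)"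
    using id_take_nth_drop[of i "take j xs"] assms by simp
  moreover have "xs = take l xs @ xs ! l # drop (Suc l) xs"
    using id_take_nth_drop[of l xs] assms by simp
  ultimately have "xs = take i xs @ xs ! i # drop (Suc i) (take j xs) @ xs ! j #
      drop (Suc j) (take k xs) @ xs ! k # drop (Suc k) (take l xs) @ xs ! l # drop (Suc l) xs"
    using assms by (metis append.assoc append_Cons less_imp_le_nat min.absorb1 take_take)
  then show ?thesis using that by blast
qed

lemma cycle_noncrossing:
  assumes C: "cycle E C" and no: "\<not> has_crossing_chords E"
  shows "noncrossing E C"
proof -
  have False if pos: "i < j" "j < k" "k < l" "l < length C" and ch: "{C ! i, C ! k} \<in> E" "{C ! j, C ! l} \<in> E"
    for i j k l
  proof -
    obtain as us vs ws zs where "C = as @ C ! i # us @ C ! j # vs @ C ! k # ws @ C ! l # zs"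
      using four_positions_split[OF pos] .
    then have "cycle E ((C ! i # us @ C ! j # vs @ C ! k # ws @ C ! l # zs) @ as)"
      using C cycle_swap by metis
    then show False using no ch unfolding has_crossing_chords_def by fastforce
  qed
  then show ?thesis using C unfolding noncrossing_def cycle_def by blast
qed

text \<open>A vertex cut of size at most one: disconnected graphs and graphs with a cut vertex are treated
  alike.\<close>

definition cut :: "'a set \<Rightarrow> 'a set set \<Rightarrow> 'a set \<Rightarrow> 'a set \<Rightarrow> bool" where
  "cut V E A B \<longleftrightarrow> A \<union> B = V \<and> A \<noteq> V \<and> B \<noteq> V \<and> card (A \<inter> B) \<le> 1 \<and>
     (\<forall>e \<in> E. e \<subseteq> A \<or> e \<subseteq> B)"

text \<open>A walk is shortened to a path by cutting it off as soon as it revisits a vertex.\<close>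

lemma simple_path_avoiding:
  assumes "(u, w) \<in> {(u, w). {u, w} \<in> E \<and> u \<notin> W \<and> w \<notin> W}\<^sup>*" and "u \<notin> W"
  shows "\<exists>qs. distinct qs \<and> qs \<noteq> [] \<and> hd qs = u \<and> last qs = w \<and> path_edges qs \<subseteq> E \<and> set qs \<inter> W = {}"
  using assms
proof (induction rule: rtrancl_induct)
  case base
  then show ?case by (intro exI[of _ "[u]"]) simp
next
  case (step w z)
  then obtain qs where qs: "distinct qs" "qs \<noteq> []" "hd qs = u" "last qs = w" "path_edges qs \<subseteq> E"
    "set qs \<inter> W = {}" by blast
  show ?case
  proof (cases "z \<in> set qs")
    case True
    then obtain q1 q2 where q: "qs = q1 @ z # q2" by (meson split_list)
    then have "hd (q1 @ [z]) = u" using qs(3) by (cases q1) auto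
    then show ?thesis using qs q path_edges_append[of q1 z q2] by (intro exI[of _ "q1 @ [z]"]) auto
  next
    case False
    obtain q0 where q: "qs = q0 @ [w]" using qs(2,4) by (metis append_butlast_last_id)
    then show ?thesis
      using qs False step(2) path_edges_append[of q0 w "[z]"]
      by (intro exI[of _ "qs @ [z]"]) (auto simp: hd_append)
  qed
qed

text \<open>Take a component \<open>K\<close> of the graph outside \<open>W\<close>. If \<open>K\<close> had at most one neighbour in \<open>W\<close>, then \<open>K\<close> with
  this neighbour on one side and all vertices outside \<open>K\<close> on the other would be a cut. So \<open>K\<close> has two
  neighbours in \<open>W\<close>, and they are joined by a path through \<open>K\<close>.\<close>

lemma ear_of_cycle:
  assumes E: "\<And>e. e \<in> E \<Longrightarrow> e \<subseteq> V \<and> card e = 2" and nocut: "\<And>A B. \<not> cut V E A B"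
    and W: "W \<subset> V" "finite W" "2 \<le> card W"
  obtains x y qs where "x \<in> W" "y \<in> W" "x \<noteq> y" "qs \<noteq> []" "distinct qs" "set qs \<inter> W = {}"
    "path_edges (x # qs @ [y]) \<subseteq> E"
proof -
  define R where "R = {(u, w). {u, w} \<in> E \<and> u \<notin> W \<and> w \<notin> W}"
  obtain v where v: "v \<in> V" "v \<notin> W" using W by blast
  define K where "K = {k. (v, k) \<in> R\<^sup>*}"
  define N where "N = {x \<in> W. \<exists>k \<in> K. {k, x} \<in> E}"
  have KW: "K \<inter> W = {}"
  proof -
    have "k \<notin> W" if "(v, k) \<in> R\<^sup>*" for k using that v(2) by (induction) (auto simp: R_def)
    then show ?thesis unfolding K_def by blast
  qed
  have KV: "K \<subseteq> V"
  proof -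
    have "k \<in> V" if "(v, k) \<in> R\<^sup>*" for k using that v(1) E by (induction) (auto simp: R_def)
    then show ?thesis unfolding K_def by blast
  qed
  have vK: "v \<in> K" unfolding K_def by simp
  have symR: "sym R" unfolding R_def sym_def by (auto simp: insert_commute)
  have "\<exists>x \<in> N. \<exists>y \<in> N. x \<noteq> y"
  proof (rule ccontr)
    assume "\<not> ?thesis"
    then have N1: "card N \<le> 1"
      using W(2) card_le_Suc0_iff_eq[of N] unfolding N_def by auto
    have "e \<subseteq> K \<union> N \<or> e \<subseteq> V - K" if e: "e \<in> E" for e
    proof (cases "e \<inter> K = {}")
      case True then show ?thesis using E[OF e] by blast
    next
      case False
      then obtain s where s: "s \<in> e" "s \<in> K" by blast
      then obtain t where t: "e = {s, t}" using E[OF e] by (metis card_2_iff insert_commute insert_iff singletonD)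
      have "t \<in> K \<union> N"
      proof (cases "t \<in> W")
        case True then show ?thesis using s t e unfolding N_def by blast
      next
        case False
        then have "(s, t) \<in> R" using s t e KW unfolding R_def by blast
        then show ?thesis using s(2) unfolding K_def by (auto intro: rtrancl_into_rtrancl)
      qed
      then show ?thesis using s t by blast
    qed
    moreover have "(K \<union> N) \<inter> (V - K) = N" using KW W unfolding N_def by blast
    moreover have "K \<union> N \<noteq> V"
    proof
      assume "K \<union> N = V"
      then have "W \<subseteq> N" using KW W by blast
      then show False using N1 W(2,3) card_mono[of N W] finite_subset[of N W] N_def by auto
    qed
    ultimately have "cut V E (K \<union> N) (V - K)"
      unfolding cut_def using N1 KV vK W v N_def by auto
    then show False using nocut by blast
  qed
  then obtain x y k1 k2 where xy: "x \<in> W" "y \<in> W" "x \<noteq> y" and k: "k1 \<in> K" "k2 \<in> K"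
    and e: "{k1, x} \<in> E" "{k2, y} \<in> E" unfolding N_def by blast
  have "(k1, v) \<in> R\<^sup>*" "(v, k2) \<in> R\<^sup>*"
    using k sym_rtrancl[OF symR] unfolding K_def sym_def by auto
  then have "(k1, k2) \<in> R\<^sup>*" by (rule rtrancl_trans)
  then obtain qs where qs: "distinct qs" "qs \<noteq> []" "hd qs = k1" "last qs = k2" "path_edges qs \<subseteq> E"
    "set qs \<inter> W = {}"
    using simple_path_avoiding[of k1 k2 E W] k(1) KW unfolding R_def by blast
  have "path_edges (x # qs @ [y]) \<subseteq> E"
  proof -
    obtain q0 where q0: "qs = q0 @ [k2]" using qs(2,4) by (metis append_butlast_last_id)
    have "path_edges (qs @ [y]) \<subseteq> E"
      using path_edges_append[of q0 k2 "[y]"] q0 qs(5) e(2) by auto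
    then show ?thesis using qs(2,3) e(1) by (cases qs) (auto simp: insert_commute)
  qed
  then show ?thesis using that xy qs by blast
qed

text \<open>A longest cycle misses no vertex: otherwise it has an ear. If the ends of the ear are consecutive
  on the cycle, going through the ear gives a longer cycle; if not, the ear and the two parts of
  the cycle are three paths with inner vertices, a subdivision of \<open>K\<^sub>2\<^sub>,\<^sub>3\<close>.\<close>

lemma Hamiltonian_cycle_if_no_cut:
  assumes V: "finite V" "2 \<le> card V" and E: "\<And>e. e \<in> E \<Longrightarrow> e \<subseteq> V \<and> card e = 2"
    and nocut: "\<And>A B. \<not> cut V E A B" and no: "\<not> has_K23_subdivision E"
  obtains C where "cycle E C" "set C = V"
proof -
  have "E \<noteq> {}"
  proof
    assume "E = {}"
    obtain a where a: "a \<in> V" using V by (metis card.empty ex_in_conv not_numeral_le_zero)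
    have "V \<noteq> {a}" using V(2) by auto
    then have "cut V E {a} (V - {a})" using a \<open>E = {}\<close> unfolding cut_def by auto
    then show False using nocut by blast
  qed
  then obtain a b where ab: "{a, b} \<in> E" "a \<noteq> b" using E by (metis card_2_iff ex_in_conv)
  have C0: "cycle E [a, b]" using ab by (simp add: cycle_def insert_commute)
  have inV: "set C \<subseteq> V" if "cycle E C" for C
  proof -
    have "\<Union> (path_edges (C @ [hd C])) = set (C @ [hd C])"
      using that unfolding cycle_def by (intro Union_path_edges_eq) auto
    then show ?thesis using that E unfolding cycle_def by (auto 4 3)
  qed
  then have "length C \<le> card V" if "cycle E C" for C
    using that V(1) card_mono distinct_card unfolding cycle_def by metis
  then obtain C where C: "cycle E C" and longest: "\<And>D. cycle E D \<Longrightarrow> length D \<le> length C"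
    using ex_has_greatest_nat[of "cycle E" "[a, b]" length "Suc (card V)"] C0
    by (auto simp: less_Suc_eq_le)
  have "set C = V"
  proof (rule ccontr)
    assume "set C \<noteq> V"
    then have W: "set C \<subset> V" using inV[OF C] by blast
    have "2 \<le> card (set C)" using C distinct_card unfolding cycle_def by metis
    then obtain x y qs where xy: "x \<in> set C" "y \<in> set C" "x \<noteq> y"
      and qs: "qs \<noteq> []" "distinct qs" "set qs \<inter> set C = {}" "path_edges (x # qs @ [y]) \<subseteq> E"
      using ear_of_cycle[OF E nocut W] by auto
    obtain us vs where D: "cycle E (x # us @ y # vs)" "set (x # us @ y # vs) = set C"
      "length (x # us @ y # vs) = length C" using cycle_through_two[OF C xy] .
    have qs_rev: "path_edges (y # rev qs @ [x]) \<subseteq> E"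
      using path_edges_rev[of "x # qs @ [y]"] qs(4) by simp
    have dist: "distinct (x # y # us @ vs @ qs)"
      using D(1,2) qs(2,3) unfolding cycle_two_paths by auto
    consider "us = []" | "vs = []" | "us \<noteq> []" "vs \<noteq> []" by blast
    then show False
    proof cases
      case 1
      then have "cycle E (x # qs @ y # vs)"
        using D(1) dist qs(4) unfolding cycle_two_paths by auto
      then show False using longest[of "x # qs @ y # vs"] D(3) 1 qs(1) by (cases qs) auto
    next
      case 2
      then have "cycle E (x # us @ y # rev qs)"
        using D(1) dist qs_rev unfolding cycle_two_paths by auto
      then show False using longest[of "x # us @ y # rev qs"] D(3) 2 qs(1) by (cases qs) auto
    next
      case 3
      have "path_edges (x # rev vs @ [y]) \<subseteq> E"
        using path_edges_rev[of "y # vs @ [x]"] D(1) unfolding cycle_two_paths by simp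
      then have "has_K23_subdivision E"
        unfolding has_K23_subdivision_def using dist 3 qs D(1)
        by (intro exI[of _ x] exI[of _ y] exI[of _ us] exI[of _ "rev vs"] exI[of _ qs])
          (auto simp: cycle_two_paths)
      then show False using no by blast
    qed
  qed
  then show ?thesis using that C by blast
qed

lemma has_K23_subdivision_mono: "\<lbrakk>has_K23_subdivision F; F \<subseteq> E\<rbrakk> \<Longrightarrow> has_K23_subdivision E"
  unfolding has_K23_subdivision_def by (meson order_trans)

lemma has_crossing_chords_mono: "\<lbrakk>has_crossing_chords F; F \<subseteq> E\<rbrakk> \<Longrightarrow> has_crossing_chords E"
  unfolding has_crossing_chords_def cycle_def by (meson order_trans subsetD)

text \<open>By induction on the vertex set: at a cut, orders of the two sides are rotated so that the common
  vertex is last in one and first in the other, and then glued. Without a cut, a Hamiltonian cycle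
  is such an order, because two crossing edges would be crossing chords of it.\<close>

theorem noncrossing_order_exists:
  assumes "finite V" and "\<And>e. e \<in> E \<Longrightarrow> e \<subseteq> V \<and> card e = 2"
    and "\<not> has_K23_subdivision E" and "\<not> has_crossing_chords E"
  shows "\<exists>xs. noncrossing E xs \<and> set xs = V"
  using assms
proof (induction V arbitrary: E rule: finite_psubset_induct)
  case (psubset V)
  consider "card V < 2" | A B where "cut V E A B" | "2 \<le> card V" "\<And>A B. \<not> cut V E A B"
    by fastforce
  then show ?case
  proof cases
    case 1
    obtain xs where "distinct xs" "set xs = V" using finite_distinct_list psubset.hyps by blast
    moreover then have "length xs < 2" using 1 distinct_card by fastforce
    ultimately show ?thesis unfolding noncrossing_def by auto
  next
    case (2 A B)
    then have AB: "A \<union> B = V" "A \<subset> V" "B \<subset> V" "card (A \<inter> B) \<le> 1"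
      and cut: "\<And>e. e \<in> E \<Longrightarrow> e \<subseteq> A \<or> e \<subseteq> B" unfolding cut_def by auto
    have part: "\<exists>xs. noncrossing E xs \<and> set xs = X" if "X \<subset> V" for X
    proof -
      have "\<exists>xs. noncrossing {e \<in> E. e \<subseteq> X} xs \<and> set xs = X"
        using psubset.prems has_K23_subdivision_mono[of "{e \<in> E. e \<subseteq> X}" E]
          has_crossing_chords_mono[of "{e \<in> E. e \<subseteq> X}" E]
        by (intro psubset.IH[OF that]) auto
      then show ?thesis using noncrossing_induced by blast
    qed
    obtain xs ys where xs: "noncrossing E xs" "set xs = A" and ys: "noncrossing E ys" "set ys = B"
      using part[OF AB(2)] part[OF AB(3)] by auto
    have "\<exists>xs vs ys. noncrossing E (xs @ vs) \<and> set (xs @ vs) = A \<and> noncrossing E (vs @ ys) \<and>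
        set (vs @ ys) = B \<and> set vs = A \<inter> B \<and> length vs \<le> 1"
    proof (cases "A \<inter> B = {}")
      case True
      then show ?thesis using xs ys by (intro exI[of _ xs] exI[of _ "[]"] exI[of _ ys]) simp
    next
      case False
      have "finite A" using AB psubset.hyps by (meson finite_subset psubset_imp_subset)
      then obtain v where v: "A \<inter> B = {v}"
        using False AB(4) by (metis card_1_singletonE card_0_eq finite_Int le_SucE le_zero_eq One_nat_def)
      have "v \<in> set xs" "v \<in> set ys" using v xs ys by auto
      then obtain x1 x2 y1 y2 where s: "xs = x1 @ v # x2" "ys = y1 @ v # y2"
        by (meson split_list)
      have "noncrossing E (x2 @ x1 @ [v])" using noncrossing_swap[of E "x1 @ [v]" x2] xs s by simp
      moreover have "noncrossing E (v # y2 @ y1)" using noncrossing_swap[of E y1 "v # y2"] ys s by simp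
      moreover have "set (x2 @ x1 @ [v]) = A" "set (v # y2 @ y1) = B" using xs ys s by auto
      ultimately have "noncrossing E ((x2 @ x1) @ [v]) \<and> set ((x2 @ x1) @ [v]) = A \<and>
          noncrossing E ([v] @ y2 @ y1) \<and> set ([v] @ y2 @ y1) = B \<and> set [v] = A \<inter> B \<and> length [v] \<le> 1"
        using v by simp
      then show ?thesis by blast
    qed
    then obtain xs vs ys where L: "noncrossing E (xs @ vs)" "set (xs @ vs) = A"
      and R: "noncrossing E (vs @ ys)" "set (vs @ ys) = B" and vs: "set vs = A \<inter> B" "length vs \<le> 1"
      by blast
    have "noncrossing E (xs @ vs @ ys)"
    proof (rule noncrossing_glue[OF L(1) R(1) _ vs(2)])
      show "distinct (xs @ vs @ ys)" using L R vs(1) unfolding noncrossing_def by auto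
      show "e \<subseteq> set (xs @ vs) \<or> e \<subseteq> set (vs @ ys)" if "e \<in> E" for e
        using cut[OF that] L(2) R(2) by simp
    qed
    moreover have "set (xs @ vs @ ys) = V" using L R AB(1) by auto
    ultimately show ?thesis by blast
  next
    case 3
    then obtain C where "cycle E C" "set C = V"
      using Hamiltonian_cycle_if_no_cut[OF psubset.hyps _ psubset.prems(1) _ psubset.prems(2)] by blast
    then show ?thesis using cycle_noncrossing psubset.prems(3) by blast
  qed
qed

section \<open>Straight-line drawings on a parabola\<close>

text \<open>A parabola is a strictly convex curve with polynomial coordinates, so that incidences of chords
  become polynomial identities.\<close>

definition parabola :: "real \<Rightarrow> complex" where
  "parabola t = Complex t (t\<^sup>2)"

lemma parabola_eq_iff: "parabola s = parabola t \<longleftrightarrow> s = t"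
  by (auto simp: parabola_def)

lemma chord_point:
  assumes "z \<in> closed_segment (parabola a) (parabola b)"
  obtains u where "0 \<le> u" "u \<le> 1" "Re z = (1 - u) * a + u * b" "Im z = (1 - u) * a\<^sup>2 + u * b\<^sup>2"
proof -
  obtain u where "0 \<le> u" "u \<le> 1" "z = (1 - u) *\<^sub>R parabola a + u *\<^sub>R parabola b"
    using assms unfolding in_segment by blast
  then show ?thesis using that[of u] by (simp add: parabola_def)
qed

lemma parabola_on_chord:
  assumes "parabola t \<in> closed_segment (parabola a) (parabola b)"
  shows "t = a \<or> t = b"
proof -
  obtain u where "t = (1 - u) * a + u * b" "t\<^sup>2 = (1 - u) * a\<^sup>2 + u * b\<^sup>2"
    using chord_point[OF assms] by (auto simp: parabola_def)
  then have "(t - a) * (t - b) = 0" by (simp add: power2_eq_square) algebra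
  then show ?thesis by simp
qed

lemma chord_above_parabola:
  assumes "z \<in> closed_segment (parabola a) (parabola b)"
  shows "(Re z)\<^sup>2 \<le> Im z"
proof -
  obtain u where u: "0 \<le> u" "u \<le> 1" "Re z = (1 - u) * a + u * b" "Im z = (1 - u) * a\<^sup>2 + u * b\<^sup>2"
    using chord_point[OF assms] .
  have "Im z - (Re z)\<^sup>2 = u * (1 - u) * (b - a)\<^sup>2"
    unfolding u(3,4) power2_eq_square by algebra
  then show ?thesis using u(1,2) by (metis diff_ge_0_iff_ge mult_nonneg_nonneg zero_le_power2)
qed

text \<open>The function \<open>Im z - (a + b) * Re z + a * b\<close> vanishes on the line through the points at \<open>a\<close> and \<open>b\<close>
  and takes the value \<open>(t - a) * (t - b)\<close> at the point of the parabola with parameter \<open>t\<close>. Along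
  the inner chord it is a convex combination of two values that are not positive, so it vanishes only
  where the chords share an end.\<close>

lemma nested_chords_meet:
  assumes z: "z \<in> closed_segment (parabola a) (parabola b)" "z \<in> closed_segment (parabola c) (parabola d)"
    and nested: "a \<le> c" "c < d" "d \<le> b" and ne: "a \<noteq> c \<or> b \<noteq> d"
  shows "z \<in> parabola ` ({a, b} \<inter> {c, d})"
proof -
  obtain u where u: "Re z = (1 - u) * a + u * b" "Im z = (1 - u) * a\<^sup>2 + u * b\<^sup>2"
    using chord_point[OF z(1)] by metis
  obtain v where v: "0 \<le> v" "v \<le> 1" "Re z = (1 - v) * c + v * d" "Im z = (1 - v) * c\<^sup>2 + v * d\<^sup>2"
    using chord_point[OF z(2)] by metis
  have "Im z - (a + b) * Re z + a * b = 0"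
    unfolding u power2_eq_square by algebra
  then have sum: "(1 - v) * ((c - a) * (b - c)) + v * ((d - a) * (b - d)) = 0"
    unfolding v power2_eq_square by algebra
  have "0 \<le> (1 - v) * ((c - a) * (b - c))" "0 \<le> v * ((d - a) * (b - d))"
    using v nested by (auto intro!: mult_nonneg_nonneg)
  then have "(1 - v) * ((c - a) * (b - c)) = 0" "v * ((d - a) * (b - d)) = 0" using sum by linarith+
  then have "v = 1 \<or> c = a" "v = 0 \<or> d = b" using nested by auto
  then have "(v = 1 \<and> d = b) \<or> (v = 0 \<and> c = a)" using ne by auto
  then show ?thesis
    using v(3,4) by (auto simp: parabola_def complex_eq_iff image_iff)
qed

lemma chord_end:
  assumes z: "z \<in> closed_segment (parabola a) (parabola b)" and "a < b"
  shows "a \<le> Re z" "Re z \<le> b" "Re z = a \<Longrightarrow> z = parabola a" "Re z = b \<Longrightarrow> z = parabola b"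
proof -
  obtain u where u: "0 \<le> u" "u \<le> 1" "Re z = (1 - u) * a + u * b" "Im z = (1 - u) * a\<^sup>2 + u * b\<^sup>2"
    using chord_point[OF z] .
  have Re: "Re z - a = u * (b - a)" "b - Re z = (1 - u) * (b - a)" unfolding u(3) by algebra+
  then show "a \<le> Re z" "Re z \<le> b"
    using u(1,2) \<open>a < b\<close> by (metis diff_ge_0_iff_ge less_imp_le mult_nonneg_nonneg)+
  show "z = parabola a" if "Re z = a"
  proof -
    have "u = 0" using Re(1) that \<open>a < b\<close> by simp
    then show ?thesis using u by (simp add: parabola_def complex_eq_iff)
  qed
  show "z = parabola b" if "Re z = b"
  proof -
    have "u = 1" using Re(2) that \<open>a < b\<close> by simp
    then show ?thesis using u by (simp add: parabola_def complex_eq_iff)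
  qed
qed

lemma chords_meet:
  assumes ab: "a < b" and cd: "c < d" and ne: "a \<noteq> c \<or> b \<noteq> d"
    and nocross: "\<not> (a < c \<and> c < b \<and> b < d)" "\<not> (c < a \<and> a < d \<and> d < b)"
  shows "closed_segment (parabola a) (parabola b) \<inter> closed_segment (parabola c) (parabola d)
    \<subseteq> parabola ` ({a, b} \<inter> {c, d})"
proof
  fix z assume "z \<in> closed_segment (parabola a) (parabola b) \<inter> closed_segment (parabola c) (parabola d)"
  then have z: "z \<in> closed_segment (parabola a) (parabola b)" "z \<in> closed_segment (parabola c) (parabola d)"
    by auto
  note ends = chord_end[OF z(1) ab] chord_end[OF z(2) cd]
  consider "b \<le> c" | "d \<le> a" | "a \<le> c" "d \<le> b" | "c \<le> a" "b \<le> d" using nocross by linarith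
  then show "z \<in> parabola ` ({a, b} \<inter> {c, d})"
  proof cases
    case 1
    then have "b = c" "Re z = b" using ends by auto
    then show ?thesis using ends(4) by auto
  next
    case 2
    then have "d = a" "Re z = a" using ends by auto
    then show ?thesis using ends(3) by auto
  next
    case 3
    then show ?thesis using nested_chords_meet[OF z] cd ne by blast
  next
    case 4
    then show ?thesis using nested_chords_meet[OF z(2,1)] ab ne by (metis Int_commute)
  qed
qed

lemma convex_above_parabola: "convex {z. (Re z)\<^sup>2 \<le> Im z}"
proof (rule convexI)
  fix y z :: complex and u v :: real
  assume yz: "y \<in> {z. (Re z)\<^sup>2 \<le> Im z}" "z \<in> {z. (Re z)\<^sup>2 \<le> Im z}" and uv: "0 \<le> u" "0 \<le> v" "u + v = 1"
  have "u * (Re y)\<^sup>2 + v * (Re z)\<^sup>2 - (u * Re y + v * Re z)\<^sup>2 = u * v * (Re y - Re z)\<^sup>2"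
    using uv(3) unfolding power2_eq_square by algebra
  moreover have "0 \<le> u * v * (Re y - Re z)\<^sup>2" using uv by simp
  moreover have "u * (Re y)\<^sup>2 \<le> u * Im y" "v * (Re z)\<^sup>2 \<le> v * Im z"
    using yz uv by (auto intro: mult_left_mono)
  ultimately show "u *\<^sub>R y + v *\<^sub>R z \<in> {z. (Re z)\<^sup>2 \<le> Im z}" by simp
qed

text \<open>The region above the parabola is convex, so everything below it belongs to the outer face, and
  points of the parabola are approached vertically from below.\<close>

lemma parabola_in_outer_boundary:
  assumes S: "S \<subseteq> {z. (Re z)\<^sup>2 \<le> Im z}" and t: "parabola t \<in> S"
  shows "parabola t \<in> frontier (outside S)"
proof -
  have sub: "- {z. (Re z)\<^sup>2 \<le> Im z} \<subseteq> outside S"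
    using outside_subset_convex[OF convex_above_parabola S] .
  have "parabola t \<in> closure (outside S)"
  proof (rule closure_approachable[THEN iffD2], intro allI impI)
    fix e :: real assume "0 < e"
    let ?y = "Complex t (t\<^sup>2 - e / 2)"
    have "?y \<in> outside S" using sub \<open>0 < e\<close> by auto
    moreover have "dist ?y (parabola t) < e"
      using \<open>0 < e\<close> by (simp add: dist_norm parabola_def complex_norm_eq_1_exp cmod_def)
    ultimately show "\<exists>y \<in> outside S. dist y (parabola t) < e" by blast
  qed
  moreover have "parabola t \<notin> interior (outside S)"
    using t interior_subset[of "outside S"] outside_no_overlap[of S] by blast
  ultimately show ?thesis unfolding frontier_def by blast
qed

text \<open>The vertex at position \<open>i\<close> is placed at parameter \<open>i\<close> of the parabola and every edge is drawn as a
  straight segment.\<close>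

theorem outerplanar_if_noncrossing:
  assumes simple: "simple_graph G" and nc: "noncrossing (edges G) xs" and xs: "set xs = verts G"
  shows "outerplanar G"
proof -
  have dist: "distinct xs" using nc unfolding noncrossing_def by blast
  define ix where "ix v = real (the_inv_into {..<length xs} ((!) xs) v)" for v
  have ix: "ix (xs ! i) = real i" if "i < length xs" for i
    unfolding ix_def using that the_inv_into_f_f[of "(!) xs" "{..<length xs}" i] dist
    by (simp add: inj_on_nth)
  define p where "p v = parabola (ix v)" for v
  \<comment> \<open>Minimum and maximum orient the segment, since an edge is an unordered pair.\<close>
  define \<gamma> where "\<gamma> e = linepath (parabola (Min (ix ` e))) (parabola (Max (ix ` e)))" for e
  have p_nth: "p (xs ! i) = parabola (real i)" if "i < length xs" for i
    using ix[OF that] by (simp add: p_def)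
  have \<gamma>_chord: "\<gamma> {xs ! a, xs ! b} = linepath (parabola a) (parabola b)" if "a < b" "b < length xs" for a b
    using that by (simp add: \<gamma>_def ix)
  have edgeE: "\<exists>a b. a < b \<and> b < length xs \<and> e = {xs ! a, xs ! b}" if "e \<in> edges G" for e
  proof -
    have "e \<subseteq> set xs" "card e = 2" using that simple xs unfolding simple_graph_def by auto
    then obtain u v where uv: "e = {u, v}" "u \<noteq> v" "u \<in> set xs" "v \<in> set xs"
      by (auto simp: card_2_iff)
    then obtain a b where "a < length xs" "b < length xs" "u = xs ! a" "v = xs ! b"
      by (metis in_set_conv_nth)
    then show ?thesis using uv by (metis insert_commute nat_neq_iff)
  qed
  have vertE: "\<exists>i < length xs. v = xs ! i" if "v \<in> verts G" for v
    using that xs by (metis in_set_conv_nth)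
  have inj: "inj_on p (verts G)"
    by (rule inj_onI) (metis vertE p_nth parabola_eq_iff of_nat_eq_iff)
  have arcs: "arc (\<gamma> e) \<and> {pathstart (\<gamma> e), pathfinish (\<gamma> e)} = p ` e" if e: "e \<in> edges G" for e
  proof -
    obtain a b where ab: "a < b" "b < length xs" "e = {xs ! a, xs ! b}" using edgeE[OF e] by blast
    then show ?thesis using \<gamma>_chord[OF ab(1,2)] by (simp add: p_nth parabola_eq_iff arc_linepath)
  qed
  have avoid: "v \<in> e" if e: "e \<in> edges G" and v: "v \<in> verts G" "p v \<in> path_image (\<gamma> e)" for e v
  proof -
    obtain a b where ab: "a < b" "b < length xs" "e = {xs ! a, xs ! b}" using edgeE[OF e] by blast
    obtain i where i: "i < length xs" "v = xs ! i" using vertE[OF v(1)] by blast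
    have "real i = real a \<or> real i = real b"
      using v(2) ab i \<gamma>_chord[OF ab(1,2)] by (intro parabola_on_chord) (simp add: p_nth)
    then show ?thesis using ab i by auto
  qed
  have meet: "path_image (\<gamma> e) \<inter> path_image (\<gamma> f) \<subseteq> p ` (e \<inter> f)"
    if ef: "e \<in> edges G" "f \<in> edges G" "e \<noteq> f" for e f
  proof -
    obtain a b where ab: "a < b" "b < length xs" "e = {xs ! a, xs ! b}" using edgeE[OF ef(1)] by blast
    obtain c d where cd: "c < d" "d < length xs" "f = {xs ! c, xs ! d}" using edgeE[OF ef(2)] by blast
    have "\<not> (a < c \<and> c < b \<and> b < d)" "\<not> (c < a \<and> a < d \<and> d < b)"
      using noncrossingD[OF nc, of a c b d] noncrossingD[OF nc, of c a d b] ab cd ef by auto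
    then have "path_image (\<gamma> e) \<inter> path_image (\<gamma> f) \<subseteq>
        parabola ` ({real a, real b} \<inter> {real c, real d})"
      using chords_meet[of "real a" "real b" "real c" "real d"] ab cd ef(3) \<gamma>_chord[OF ab(1,2)]
        \<gamma>_chord[OF cd(1,2)] by auto
    also have "\<dots> \<subseteq> p ` (e \<inter> f)"
    proof
      fix z assume "z \<in> parabola ` ({real a, real b} \<inter> {real c, real d})"
      then obtain i where i: "z = parabola (real i)" "i \<in> {a, b}" "i \<in> {c, d}" by auto
      then have "z = p (xs ! i)" "xs ! i \<in> e \<inter> f" using ab cd p_nth by auto
      then show "z \<in> p ` (e \<inter> f)" by blast
    qed
    finally show ?thesis .
  qed
  have "plane_drawing G p \<gamma>"
    unfolding plane_drawing_def using inj arcs avoid meet by blast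
  moreover have above: "drawing_image G p \<gamma> \<subseteq> {z. (Re z)\<^sup>2 \<le> Im z}"
  proof -
    have "(Re z)\<^sup>2 \<le> Im z" if "e \<in> edges G" "z \<in> path_image (\<gamma> e)" for e z
      using that(2) edgeE[OF that(1)] \<gamma>_chord chord_above_parabola by fastforce
    then show ?thesis unfolding drawing_image_def p_def parabola_def by auto
  qed
  moreover have "p v \<in> frontier (outside (drawing_image G p \<gamma>))" if "v \<in> verts G" for v
    using parabola_in_outer_boundary[OF above, of "ix v"] that
    by (auto simp: drawing_image_def p_def)
  ultimately show ?thesis using simple unfolding outerplanar_def by blast
qed

section \<open>Triangulations and fans in maximal outerplanar graphs\<close>

lemma noncrossing_insert:
  assumes nc: "noncrossing E xs" and ij: "i < j" "j < length xs"
    and free: "\<And>k l. \<lbrakk>i < k; k < j; l < length xs; l < i \<or> j < l\<rbrakk> \<Longrightarrow> {xs ! k, xs ! l} \<notin> E"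
  shows "noncrossing (insert {xs ! i, xs ! j} E) xs"
proof -
  have dist: "distinct xs" using nc unfolding noncrossing_def by blast
  have new: "{xs ! s, xs ! t} = {xs ! i, xs ! j} \<longleftrightarrow> s = i \<and> t = j" if "s < t" "t < length xs" for s t
    using that ij dist by (auto simp: doubleton_eq_iff nth_eq_iff_index_eq)
  have False if abcd: "a < b" "b < c" "c < d" "d < length xs"
    and ac: "{xs ! a, xs ! c} \<in> insert {xs ! i, xs ! j} E"
    and bd: "{xs ! b, xs ! d} \<in> insert {xs ! i, xs ! j} E" for a b c d
  proof -
    have 1: "(a = i \<and> c = j) \<or> {xs ! a, xs ! c} \<in> E" using ac new[of a c] abcd by auto
    have 2: "(b = i \<and> d = j) \<or> {xs ! b, xs ! d} \<in> E" using bd new[of b d] abcd by auto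
    show False
      using 1 2 noncrossingD[OF nc abcd] free[of b d] free[of c a] abcd
      by (auto simp: insert_commute)
  qed
  then show ?thesis using dist unfolding noncrossing_def by blast
qed

lemma maximal_outerplanar_adjacent:
  assumes G: "maximal_outerplanar G" and nc: "noncrossing (edges G) xs" and xs: "set xs = verts G"
    and ij: "i < j" "j < length xs"
    and free: "\<And>k l. \<lbrakk>i < k; k < j; l < length xs; l < i \<or> j < l\<rbrakk> \<Longrightarrow> {xs ! k, xs ! l} \<notin> edges G"
  shows "{xs ! i, xs ! j} \<in> edges G"
proof (rule ccontr)
  assume new: "{xs ! i, xs ! j} \<notin> edges G"
  let ?G = "G\<lparr>edges := insert {xs ! i, xs ! j} (edges G)\<rparr>"
  have ends: "xs ! i \<in> verts G" "xs ! j \<in> verts G"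
    using nth_mem[of i xs] nth_mem[of j xs] ij xs by simp_all
  have ne: "xs ! i \<noteq> xs ! j" using nc ij unfolding noncrossing_def by (simp add: nth_eq_iff_index_eq)
  have "simple_graph G" using G unfolding maximal_outerplanar_def outerplanar_def by blast
  then have "simple_graph ?G" using ends ne unfolding simple_graph_def by auto
  moreover have "noncrossing (edges ?G) xs" using noncrossing_insert[OF nc ij free] by simp
  ultimately have "outerplanar ?G" using xs by (intro outerplanar_if_noncrossing) auto
  then show False using G new ends ne unfolding maximal_outerplanar_def by blast
qed

text \<open>The order presents \<open>G\<close> as a triangulated convex polygon, and vertices are represented by their
  positions along it.\<close>

locale maximal_outerplanar_order =
  fixes G :: "'a sgraph" and xs
  assumes maximal: "maximal_outerplanar G" and nc: "noncrossing (edges G) xs"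
    and set_xs: "set xs = verts G"
begin

definition adj :: "nat \<Rightarrow> nat \<Rightarrow> bool" where
  "adj i j \<longleftrightarrow> {xs ! i, xs ! j} \<in> edges G"

lemma adj_sym: "adj i j \<Longrightarrow> adj j i"
  by (simp add: adj_def insert_commute)

lemma uncrossed_adj:
  assumes "i < j" "j < length xs"
    and "\<And>k l. \<lbrakk>i < k; k < j; l < length xs; l < i \<or> j < l\<rbrakk> \<Longrightarrow> \<not> adj k l"
  shows "adj i j"
  using maximal_outerplanar_adjacent[OF maximal nc set_xs] assms unfolding adj_def by blast

lemma not_crossing: "\<lbrakk>adj i k; i < j; j < k; k < l; l < length xs\<rbrakk> \<Longrightarrow> \<not> adj j l"
  using noncrossingD[OF nc] unfolding adj_def by blast

text \<open>The apex is the last neighbour \<open>k\<close> of \<open>i\<close> before \<open>j\<close>. An edge crossing the segment from \<open>k\<close> to \<open>j\<close> would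
  cross \<open>i j\<close> or \<open>i k\<close>, or end at \<open>i\<close> and contradict the choice of \<open>k\<close>; so maximality provides \<open>k j\<close>.\<close>

lemma triangle_below:
  assumes ij: "adj i j" "Suc i < j" "j < length xs"
  obtains k where "i < k" "k < j" "adj i k" "adj k j"
proof -
  define K where "K = {k. i < k \<and> k < j \<and> adj i k}"
  have "adj i (Suc i)" using ij by (intro uncrossed_adj) auto
  then have "Suc i \<in> K" using ij unfolding K_def by auto
  moreover have fin: "finite K" unfolding K_def by simp
  ultimately have "Max K \<in> K" using Max_in by blast
  then have k: "i < Max K" "Max K < j" "adj i (Max K)" unfolding K_def by auto
  have "adj (Max K) j"
  proof (rule uncrossed_adj[OF k(2) ij(3)])
    fix m l assume m: "Max K < m" "m < j" and l: "l < length xs" "l < Max K \<or> j < l"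
    show "\<not> adj m l"
    proof
      assume ml: "adj m l"
      consider "j < l" | "l < i" | "l = i" | "i < l" "l < Max K" using l by linarith
      then show False
      proof cases
        case 1 then show False using not_crossing[OF ij(1), of m l] ml m k l by simp
      next
        case 2 then show False using not_crossing[OF adj_sym[OF ml], of i j] ij m k by simp
      next
        case 3
        then have "m \<in> K" using m k adj_sym[OF ml] unfolding K_def by simp
        then show False using Max_ge[OF fin] m by fastforce
      next
        case 4 then show False using not_crossing[OF k(3), of l m] adj_sym[OF ml] m ij by simp
      qed
    qed
  qed
  then show ?thesis using that k by blast
qed

text \<open>Start with the triangle on the side from the first to the last vertex and add two more triangles across
  edges that do not join consecutive positions; three triangles glued in this way always
  form a fan. The cases differ in which edges carry a further triangle, and thus in the hub.\<close>

lemma fan_on_five_positions: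
  assumes "5 \<le> length xs"
  obtains h a b c d where "distinct [h, a, b, c, d]" "set [h, a, b, c, d] \<subseteq> {..<length xs}"
    "adj h a" "adj h b" "adj h c" "adj h d" "adj a b" "adj b c" "adj c d"
proof -
  define n where "n = length xs - 1"
  have n: "4 \<le> n" "n < length xs" using assms unfolding n_def by auto
  have n0: "adj 0 n" using n by (intro uncrossed_adj) (auto simp: n_def)
  then obtain k where k: "0 < k" "k < n" "adj 0 k" "adj k n"
    using triangle_below[of 0 n] n by auto
  consider "2 \<le> k" "k + 2 \<le> n" | "k = 1" | "k + 1 = n" using k by linarith
  then show ?thesis
  proof cases
    case 1
    obtain m where m: "0 < m" "m < k" "adj 0 m" "adj m k"
      using triangle_below[OF k(3)] 1 n by auto
    obtain l where l: "k < l" "l < n" "adj k l" "adj l n"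
      using triangle_below[OF k(4)] 1 n by auto
    show ?thesis
      by (rule that[of k m 0 n l])
        (use k m l n n0 k(3,4)[THEN adj_sym] m(3,4)[THEN adj_sym] l(3,4)[THEN adj_sym]
          n0[THEN adj_sym] in auto)
  next
    case 2
    obtain m where m: "k < m" "m < n" "adj k m" "adj m n"
      using triangle_below[OF k(4)] 2 n by auto
    consider "k + 2 \<le> m" | "m + 2 \<le> n" using m 2 n by linarith
    then show ?thesis
    proof cases
      case 1
      obtain l where l: "k < l" "l < m" "adj k l" "adj l m"
        using triangle_below[OF m(3)] 1 m n by auto
      show ?thesis by (rule that[of k 0 n m l])
        (use k m l n n0 k(3,4)[THEN adj_sym] m(3,4)[THEN adj_sym] l(3,4)[THEN adj_sym]
          n0[THEN adj_sym] in auto)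
    next
      case 2
      obtain l where l: "m < l" "l < n" "adj m l" "adj l n"
        using triangle_below[OF m(4)] 2 n by auto
      show ?thesis by (rule that[of n 0 k m l])
        (use k m l n n0 k(3,4)[THEN adj_sym] m(3,4)[THEN adj_sym] l(3,4)[THEN adj_sym]
          n0[THEN adj_sym] in auto)
    qed
  next
    case 3
    obtain m where m: "0 < m" "m < k" "adj 0 m" "adj m k"
      using triangle_below[OF k(3)] 3 n by auto
    consider "m + 2 \<le> k" | "2 \<le> m" using m 3 n by linarith
    then show ?thesis
    proof cases
      case 1
      obtain l where l: "m < l" "l < k" "adj m l" "adj l k"
        using triangle_below[OF m(4)] 1 k n by auto
      show ?thesis by (rule that[of k n 0 m l])
        (use k m l n n0 k(3,4)[THEN adj_sym] m(3,4)[THEN adj_sym] l(3,4)[THEN adj_sym]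
          n0[THEN adj_sym] in auto)
    next
      case 2
      obtain l where l: "0 < l" "l < m" "adj 0 l" "adj l m"
        using triangle_below[OF m(3)] 2 m k n by auto
      show ?thesis by (rule that[of 0 n k m l])
        (use k m l n n0 k(3,4)[THEN adj_sym] m(3,4)[THEN adj_sym] l(3,4)[THEN adj_sym]
          n0[THEN adj_sym] in auto)
    qed
  qed
qed

end

lemma maximal_outerplanar_contains_fan:
  assumes G: "maximal_outerplanar G" and card: "5 \<le> card (verts G)"
  obtains h a b c d where "distinct [h, a, b, c, d]"
    "{{h, a}, {h, b}, {h, c}, {h, d}, {a, b}, {b, c}, {c, d}} \<subseteq> edges G"
proof -
  have op: "outerplanar G" using G unfolding maximal_outerplanar_def by blast
  then have "simple_graph G" unfolding outerplanar_def by blast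
  then obtain xs where xs: "noncrossing (edges G) xs" "set xs = verts G"
    using noncrossing_order_exists[of "verts G" "edges G"] outerplanar_no_obstruction[OF op]
    unfolding simple_graph_def by blast
  interpret maximal_outerplanar_order G xs using G xs by unfold_locales
  have dist: "distinct xs" using xs(1) unfolding noncrossing_def by blast
  have len: "5 \<le> length xs" using card xs(2) distinct_card[OF dist] by simp
  obtain h a b c d where pos: "distinct [h, a, b, c, d]" "set [h, a, b, c, d] \<subseteq> {..<length xs}"
    and adj: "adj h a" "adj h b" "adj h c" "adj h d" "adj a b" "adj b c" "adj c d"
    using fan_on_five_positions[OF len] .
  show ?thesis
    using that[of "xs ! h" "xs ! a" "xs ! b" "xs ! c" "xs ! d"] pos adj dist
    by (simp add: adj_def nth_eq_iff_index_eq)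
qed

section \<open>Monochromatic paths on four vertices\<close>

lemma verts_path_graph: "verts (path_graph n) = {..<n}"
  by (simp add: path_graph_def)

lemma edges_path_graph_4: "edges (path_graph 4) = {{0, 1}, {1, 2}, {2, 3}}"
proof -
  have "Suc i < 4 \<longleftrightarrow> i = 0 \<or> i = 1 \<or> i = 2" for i by auto
  then show ?thesis unfolding path_graph_def by (auto simp: eval_nat_numeral)
qed

lemma contains_copy_P4I:
  assumes "distinct [w, x, y, z]" "set [w, x, y, z] \<subseteq> verts H"
    and "{w, x} \<in> edges H" "{x, y} \<in> edges H" "{y, z} \<in> edges H"
  shows "contains_copy H (path_graph 4)"
  unfolding contains_copy_def verts_path_graph edges_path_graph_4
proof (intro exI conjI)
  let ?f = "\<lambda>i. [w, x, y, z] ! i"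
  show "inj_on ?f {..<4}" using assms(1) inj_on_nth[of "[w, x, y, z]" "{..<4}"] by simp
  show "?f ` {..<4} \<subseteq> verts H" 
    using assms(2) by (auto simp: lessThan_Suc eval_nat_numeral)
  show "\<forall>e \<in> {{0, 1}, {1, 2}, {2, 3}}. ?f ` e \<in> edges H" using assms(3-5) by simp
qed

text \<open>The seven paths used below suffice: each of the 128 colourings of the seven edges of the fan makes
  one of them monochromatic.\<close>

lemma fan_monochromatic_P4:
  fixes c :: "'a set \<Rightarrow> colour"
  assumes dist: "distinct [h, v1, v2, v3, v4]"
    and E: "{{h, v1}, {h, v2}, {h, v3}, {h, v4}, {v1, v2}, {v2, v3}, {v3, v4}} \<subseteq> E"
  shows "\<exists>w x y z. distinct [w, x, y, z] \<and> {{w, x}, {x, y}, {y, z}} \<subseteq> E \<and>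
    c {w, x} = c {x, y} \<and> c {x, y} = c {y, z}"
proof (rule ccontr)
  assume "\<not> ?thesis"
  then have no: "\<not> (c {w, x} = c {x, y} \<and> c {x, y} = c {y, z})"
    if "distinct [w, x, y, z]" "{{w, x}, {x, y}, {y, z}} \<subseteq> E" for w x y z
    using that by blast
  have sym: "{v1, h} = {h, v1}" "{v2, h} = {h, v2}" "{v3, h} = {h, v3}" "{v4, h} = {h, v4}"
    "{v2, v1} = {v1, v2}" "{v3, v2} = {v2, v3}" "{v4, v3} = {v3, v4}" by auto
  have paths:
    "\<not> (c {h, v1} = c {h, v2} \<and> c {h, v2} = c {v2, v3})"
    "\<not> (c {h, v1} = c {h, v3} \<and> c {h, v3} = c {v3, v4})"
    "\<not> (c {v1, v2} = c {h, v2} \<and> c {h, v2} = c {h, v3})"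
    "\<not> (c {v1, v2} = c {v2, v3} \<and> c {v2, v3} = c {v3, v4})"
    "\<not> (c {h, v2} = c {h, v4} \<and> c {h, v4} = c {v3, v4})"
    "\<not> (c {v1, v2} = c {h, v1} \<and> c {h, v1} = c {h, v4})"
    "\<not> (c {v2, v3} = c {h, v3} \<and> c {h, v3} = c {h, v4})"
    using no[of v1 h v2 v3] no[of v1 h v3 v4] no[of v1 v2 h v3] no[of v1 v2 v3 v4]
      no[of v2 h v4 v3] no[of v2 v1 h v4] no[of v2 v3 h v4] dist E unfolding sym by auto
  have red_or_blue: "k = Red \<or> k = Blue" for k by (cases k) auto
  show False
    using paths red_or_blue[of "c {h, v1}"] red_or_blue[of "c {h, v2}"] red_or_blue[of "c {h, v3}"]
      red_or_blue[of "c {h, v4}"] red_or_blue[of "c {v1, v2}"] red_or_blue[of "c {v2, v3}"]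
      red_or_blue[of "c {v3, v4}"]
    by (elim disjE) simp_all
qed

lemma no_P4_on_three_vertices:
  assumes "finite T" "card T \<le> 3" and "\<And>e. e \<in> edges H \<Longrightarrow> e \<subseteq> T"
  shows "\<not> contains_copy H (path_graph 4)"
proof
  assume "contains_copy H (path_graph 4)"
  then obtain f where f: "inj_on f {..<4}" "\<forall>e \<in> {{0, 1}, {1, 2}, {2, 3::nat}}. f ` e \<in> edges H"
    unfolding contains_copy_def verts_path_graph edges_path_graph_4 by blast
  have "f 0 \<in> T" "f 1 \<in> T" "f 2 \<in> T" "f 3 \<in> T" using f(2) assms(3) by fastforce+
  moreover have "{..<4} = {0, 1, 2, 3::nat}" by auto
  ultimately have "f ` {..<4} \<subseteq> T" by auto
  then have "card (f ` {..<4}) \<le> 3" using assms(1,2) card_mono order_trans by blast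
  then show False using card_image[OF f(1)] by simp
qed

text \<open>The only missing edge is \<open>w1 w3\<close>, and with it the two diagonals are crossing chords of the
  4-cycle.\<close>

lemma diamond_maximal_outerplanar:
  assumes dist: "distinct [w0, w1, w2, w3]"
  shows "maximal_outerplanar
    \<lparr>verts = {w0, w1, w2, w3}, edges = {{w0, w1}, {w1, w2}, {w2, w3}, {w0, w3}, {w0, w2}}\<rparr>"
    (is "maximal_outerplanar ?G")
proof -
  have simple: "simple_graph ?G" using dist by (auto simp: simple_graph_def)
  have "noncrossing (edges ?G) [w0, w1, w2, w3]"
    unfolding noncrossing_def
  proof (intro conjI allI impI)
    fix i j k l :: nat
    assume "i < j" "j < k" "k < l" "l < length [w0, w1, w2, w3]"
    then have "i = 0" "j = 1" "k = 2" "l = 3" by auto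
    then show "\<not> ({[w0, w1, w2, w3] ! i, [w0, w1, w2, w3] ! k} \<in> edges ?G \<and>
        {[w0, w1, w2, w3] ! j, [w0, w1, w2, w3] ! l} \<in> edges ?G)"
      using dist by (auto simp: doubleton_eq_iff)
  qed (use dist in simp)
  then have op: "outerplanar ?G" using simple by (intro outerplanar_if_noncrossing) auto
  have K4: "\<not> outerplanar (?G\<lparr>edges := insert {u, v} (edges ?G)\<rparr>)"
    if uv: "u \<in> verts ?G" "v \<in> verts ?G" "u \<noteq> v" "{u, v} \<notin> edges ?G" for u v
  proof
    assume op': "outerplanar (?G\<lparr>edges := insert {u, v} (edges ?G)\<rparr>)"
    have uv': "{u, v} = {w1, w3}" using uv by auto
    have "cycle (insert {u, v} (edges ?G)) (w0 # [] @ w1 # [] @ w2 # [] @ w3 # [])"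
      using dist by (simp add: cycle_def insert_commute)
    moreover have "{w0, w2} \<in> insert {u, v} (edges ?G)" "{w1, w3} \<in> insert {u, v} (edges ?G)"
      using uv' by simp_all
    ultimately have "has_crossing_chords (insert {u, v} (edges ?G))"
      unfolding has_crossing_chords_def by blast
    then show False using outerplanar_no_obstruction(2)[OF op'] by simp
  qed
  show ?thesis unfolding maximal_outerplanar_def using op K4 by blast
qed

lemma forces_from_mono: "\<lbrakk>forces_from K H F M; M \<le> N\<rbrakk> \<Longrightarrow> forces_from K H F N"
  unfolding forces_from_def by (meson order_trans)

lemma P4_forced_from_5: "forces_from K_MOP (path_graph 4) (path_graph 4) 5"
  unfolding forces_from_def
proof (intro ballI allI impI)
  fix G :: "'a sgraph" and c :: "'a set \<Rightarrow> colour"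
  assume "G \<in> K_MOP" and card: "5 \<le> card (verts G)"
  then have G: "maximal_outerplanar G" unfolding K_MOP_def by simp
  then have verts: "e \<subseteq> verts G" if "e \<in> edges G" for e
    using that unfolding maximal_outerplanar_def outerplanar_def simple_graph_def by blast
  obtain w x y z where dist: "distinct [w, x, y, z]"
    and E: "{{w, x}, {x, y}, {y, z}} \<subseteq> edges G" and mono: "c {w, x} = c {x, y}" "c {x, y} = c {y, z}"
    using maximal_outerplanar_contains_fan[OF G card] fan_monochromatic_P4[of _ _ _ _ _ "edges G" c]
    by metis
  have "set [w, x, y, z] \<subseteq> verts G" using E verts by auto
  then have "contains_copy (colour_class G c (c {x, y})) (path_graph 4)"
    using E mono dist by (intro contains_copy_P4I[of w x y z]) (auto simp: colour_class_def)
  then show "contains_copy (colour_class G c Red) (path_graph 4) \<or>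
      contains_copy (colour_class G c Blue) (path_graph 4)"
    by (cases "c {x, y}") auto
qed

text \<open>In \<open>K\<^sub>4\<close> minus an edge, colour one triangle red and the two remaining edges blue: each colour
  class has edges on three vertices only.\<close>

lemma P4_not_forced_from_4:
  "\<not> forces_from (K_MOP :: 'a::infinite sgraph set) (path_graph 4) (path_graph 4) 4"
proof
  assume forces: "forces_from (K_MOP :: 'a sgraph set) (path_graph 4) (path_graph 4) 4"
  obtain W :: "'a set" where W: "card W = 4"
    using infinite_arbitrarily_large[OF infinite_UNIV] by blast
  then obtain ws where ws: "distinct ws" "set ws = W"
    using finite_distinct_list[of W] by (metis card.infinite zero_neq_numeral)
  then have "length ws = 4" using W distinct_card by metis
  then obtain w0 w1 w2 w3 where "ws = [w0, w1, w2, w3]"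
    by (auto simp: eval_nat_numeral length_Suc_conv)
  then have dist: "distinct [w0, w1, w2, w3]" using ws by simp
  define G where
    "G = \<lparr>verts = {w0, w1, w2, w3}, edges = {{w0, w1}, {w1, w2}, {w2, w3}, {w0, w3}, {w0, w2}}\<rparr>"
  define c where "c e = (if w3 \<in> e then Blue else Red)" for e
  have "G \<in> K_MOP" unfolding K_MOP_def G_def using diamond_maximal_outerplanar[OF dist] by simp
  moreover have "card (verts G) = 4" using dist by (simp add: G_def)
  moreover have "\<not> contains_copy (colour_class G c Red) (path_graph 4)"
    using dist by (intro no_P4_on_three_vertices[of "{w0, w1, w2}"])
      (auto simp: colour_class_def G_def c_def card_insert_if split: if_splits)
  moreover have "\<not> contains_copy (colour_class G c Blue) (path_graph 4)"
    using dist by (intro no_P4_on_three_vertices[of "{w0, w2, w3}"])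
      (auto simp: colour_class_def G_def c_def card_insert_if split: if_splits)
  ultimately show False using forces unfolding forces_from_def by auto
qed

theorem lemma3:
  shows "unavoidable (K_MOP :: 'a::infinite sgraph set) (path_graph 4) (path_graph 4) \<and>
         ramsey_in (K_MOP :: 'a sgraph set) (path_graph 4) (path_graph 4) = 5"
proof
  show "unavoidable (K_MOP :: 'a sgraph set) (path_graph 4) (path_graph 4)"
    unfolding unavoidable_def using P4_forced_from_5 by blast
  show "ramsey_in (K_MOP :: 'a sgraph set) (path_graph 4) (path_graph 4) = 5"
    unfolding ramsey_in_def
  proof (rule Least_equality)
    show "0 < (5::nat) \<and> forces_from (K_MOP :: 'a sgraph set) (path_graph 4) (path_graph 4) 5"
      using P4_forced_from_5 by simp
    fix N assume "0 < N \<and> forces_from (K_MOP :: 'a sgraph set) (path_graph 4) (path_graph 4) N"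
    then show "5 \<le> N"
      using P4_not_forced_from_4 forces_from_mono[of _ _ _ N 4] by fastforce
  qed
qed

end
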